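(* Let $t(x)$ be a term in one variable in the language $\{\cdot,\to,\top\}$ and let $\mathcal{WH}$ be the variety of Wajsberg hoops. Then $t(x)$ is a conucleus on $\mathcal{WH}$ if and only if $\mathcal{WH}\vDash t(x)\approx x$.
   Context: A hoop is an algebra $\langle A,\cdot,\to,\top\rangle$ such that $\langle A,\cdot,\top\rangle$ is a commutative monoid and $x\to x=\top$, $x\cdot(x\to y)=y\cdot(y\to x)$, $x\to(y\to z)=(x\cdot y)\to z$; it is partially ordered by $x\le y$ iff $x\to y=\top$. A Wajsberg hoop is a hoop satisfying $(x\to y)\to y\approx(y\to x)\to x$. A conucleus on a hoop $\mathbf{A}$ is a map $\delta\colon A\to A$ such that for all $a,b$: $\delta(a)\le a$; $a\le b$ implies $\delta(a)\le\delta(b)$; $\delta(\delta(a))=\delta(a)$; $\delta(a)\cdot\delta(b)\le\delta(a\cdot b)$; $\delta(a)\cdot\delta(\top)=\delta(a)$. A term $t(x)$ is a conucleus on a variety $\mathcal{V}$ of hoops if $t^{\mathbf{A}}$ is a conucleus on $\mathbf{A}$ for every $\mathbf{A}\in\mathcal{V}$. *)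

theory Defs
  imports "HOL-Algebra.Group"
begin

text \<open>
  The constant \<open>\<top>\<close> of a hoop is the unit \<open>\<one>\<close> of the underlying monoid.
  The implication is written \<open>\<leadsto>\<close>, since \<open>\<rightarrow>\<close> denotes function spaces in the library.
\<close>

record 'a hoop = "'a monoid" +
  himp :: "'a \<Rightarrow> 'a \<Rightarrow> 'a" (infixr "\<leadsto>\<index>" 65)

locale hoop = comm_monoid A for A (structure) +
  assumes imp_closed: "\<lbrakk>x \<in> carrier A; y \<in> carrier A\<rbrakk> \<Longrightarrow> x \<leadsto> y \<in> carrier A"
    and imp_refl: "x \<in> carrier A \<Longrightarrow> x \<leadsto> x = \<one>"
    and divisibility: "\<lbrakk>x \<in> carrier A; y \<in> carrier A\<rbrakk>
      \<Longrightarrow> x \<otimes> (x \<leadsto> y) = y \<otimes> (y \<leadsto> x)"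
    and imp_imp: "\<lbrakk>x \<in> carrier A; y \<in> carrier A; z \<in> carrier A\<rbrakk>
      \<Longrightarrow> x \<leadsto> (y \<leadsto> z) = (x \<otimes> y) \<leadsto> z"

locale wajsberg_hoop = hoop +
  assumes wajsberg: "\<lbrakk>x \<in> carrier A; y \<in> carrier A\<rbrakk>
    \<Longrightarrow> (x \<leadsto> y) \<leadsto> y = (y \<leadsto> x) \<leadsto> x"

definition hoop_le :: "('a, 'm) hoop_scheme \<Rightarrow> 'a \<Rightarrow> 'a \<Rightarrow> bool" (infix "\<preceq>\<index>" 50)
  where "x \<preceq>\<^bsub>A\<^esub> y \<longleftrightarrow> x \<leadsto>\<^bsub>A\<^esub> y = \<one>\<^bsub>A\<^esub>"

locale conucleus = hoop +
  fixes \<delta> :: "'a \<Rightarrow> 'a"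
  assumes closed: "a \<in> carrier A \<Longrightarrow> \<delta> a \<in> carrier A"
    and contracting: "a \<in> carrier A \<Longrightarrow> \<delta> a \<preceq> a"
    and monotone: "\<lbrakk>a \<in> carrier A; b \<in> carrier A; a \<preceq> b\<rbrakk> \<Longrightarrow> \<delta> a \<preceq> \<delta> b"
    and idempotent: "a \<in> carrier A \<Longrightarrow> \<delta> (\<delta> a) = \<delta> a"
    and submultiplicative: "\<lbrakk>a \<in> carrier A; b \<in> carrier A\<rbrakk> \<Longrightarrow> \<delta> a \<otimes> \<delta> b \<preceq> \<delta> (a \<otimes> b)"
    and mult_top: "a \<in> carrier A \<Longrightarrow> \<delta> a \<otimes> \<delta> \<one> = \<delta> a"

datatype hoop_term =
    Var
  | Top
  | Mult hoop_term hoop_term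
  | Imp hoop_term hoop_term

primrec term_op :: "('a, 'm) hoop_scheme \<Rightarrow> hoop_term \<Rightarrow> 'a \<Rightarrow> 'a" where
  "term_op A Var x = x"
| "term_op A Top x = \<one>\<^bsub>A\<^esub>"
| "term_op A (Mult s t) x = term_op A s x \<otimes>\<^bsub>A\<^esub> term_op A t x"
| "term_op A (Imp s t) x = term_op A s x \<leadsto>\<^bsub>A\<^esub> term_op A t x"

text \<open>
  HOL cannot quantify over all types inside a formula, so a class of hoops is represented by
  its members whose carriers are subsets of a universe type \<open>'a\<close>.
  This universe must be infinite to be representative: on a type with exactly three elements,
  the term \<open>x \<cdot> x\<close> is a conucleus on every Wajsberg hoop, but it is not the identity on the
  three-element Lukasiewicz chain.
\<close>

definition WH :: "'a hoop set"
  where "WH = {A. wajsberg_hoop A}"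

definition conucleus_term_on :: "'a hoop set \<Rightarrow> hoop_term \<Rightarrow> bool"
  where "conucleus_term_on V t \<longleftrightarrow> (\<forall>A\<in>V. conucleus A (term_op A t))"

definition satisfies_eq :: "'a hoop set \<Rightarrow> hoop_term \<Rightarrow> hoop_term \<Rightarrow> bool"
    (\<open>(_ \<Turnstile>/ _ \<approx> _)\<close> [51, 51, 51] 50)
  where "V \<Turnstile> s \<approx> t \<longleftrightarrow> (\<forall>A\<in>V. \<forall>x\<in>carrier A. term_op A s x = term_op A t x)"

end

theory Submission
  imports Defs "HOL-Algebra.Divisibility"
begin

text \<open>
  A Wajsberg hoop is a subdirect product of chains, so it suffices to show that \<open>t\<close> is the
  identity on a chain \<open>A\<close>. Evaluating \<open>t\<close> in the natural numbers under addition shows that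
  \<open>t\<close> has degree 1, hence \<open>t\<close> fixes every element of a chain with sufficiently many distinct
  powers; this settles unbounded chains. A chain with least element \<open>z\<close> is the interval from \<open>z\<close>
  to \<open>\<one>\<close> in a cancellative chain, and \<open>k\<close>-th powers embed it into the interval from the \<open>k\<close>-th
  power of \<open>z\<close> to \<open>\<one>\<close>. For large \<open>k\<close> the term fixes each \<open>x \<ge> z\<close> in this longer interval.
  Submultiplicativity of the conucleus then forces \<open>t\<close> to fix the \<open>k\<close>-th power of \<open>x\<close>, which is
  the image of \<open>x\<close>.
\<close>

section \<open>Hoops and Wajsberg hoops\<close>

context hoop
begin

text \<open>Divisibility against \<open>\<one>\<close> gives
  \<open>\<one> \<leadsto> x = x \<otimes> (x \<leadsto> \<one>)\<close>, so the two identities are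
  one fact. With \<open>c = x \<leadsto> \<one>\<close> and \<open>x' = x \<otimes> c\<close>,
  divisibility for \<open>x\<close> and \<open>x'\<close> yields
  \<open>x = x' \<otimes> (c \<leadsto> \<one>)\<close>, and \<open>c\<close> absorbs
  \<open>c \<leadsto> \<one>\<close>.\<close>

lemma mult_imp_one_and_one_imp:
  assumes x: "x \<in> carrier A"
  shows "x \<otimes> (x \<leadsto> \<one>) = x" "\<one> \<leadsto> x = x"
proof -
  let ?c = "x \<leadsto> \<one>" and ?x' = "\<one> \<leadsto> x"
  have c: "?c \<in> carrier A" "?x' \<in> carrier A" "?c \<leadsto> \<one> \<in> carrier A"
    using x by (simp_all add: imp_closed)
  have x': "?x' = x \<otimes> ?c"
    using divisibility[of \<one> x] x c by simp
  have c1: "?c \<otimes> (?c \<leadsto> \<one>) = ?c"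
    using divisibility[of ?c \<one>] imp_imp[of \<one> x \<one>] x c by simp
  have "x \<leadsto> ?x' = \<one>"
    using imp_imp[of x \<one> x] x by (simp add: imp_refl)
  then have "?x' \<otimes> (?x' \<leadsto> x) = x"
    using divisibility[of x ?x'] x c by simp
  moreover have "?x' \<leadsto> x = ?c \<leadsto> \<one>"
    using imp_imp[of ?c x x] x c by (simp add: x' imp_refl m_comm)
  ultimately have "x = x \<otimes> ?c \<otimes> (?c \<leadsto> \<one>)" by (simp add: x')
  also have "\<dots> = x \<otimes> ?c" using x c c1 by (simp add: m_assoc)
  finally show "x \<otimes> ?c = x" by simp
  then show "?x' = x" by (simp add: x')
qed

lemmas one_imp [simp] = mult_imp_one_and_one_imp(2)

text \<open>Let \<open>c = x \<leadsto> \<one>\<close>. Replacing \<open>\<one>\<close> by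
  \<open>y \<leadsto> y\<close> shows \<open>c = y \<leadsto> (x \<leadsto> y)\<close> for every
  \<open>y\<close>. At \<open>y = c\<close>, together with \<open>x \<leadsto> c = c\<close>, this
  becomes \<open>c = c \<leadsto> c\<close>.\<close>

lemma imp_one [simp]:
  assumes x: "x \<in> carrier A"
  shows "x \<leadsto> \<one> = \<one>"
proof -
  let ?c = "x \<leadsto> \<one>"
  have c: "?c \<in> carrier A" using x by (simp add: imp_closed)
  have a: "?c = y \<leadsto> (x \<leadsto> y)" if "y \<in> carrier A" for y
    using imp_imp[of x y y] imp_imp[of y x y] x that by (simp add: imp_refl m_comm)
  have "x \<leadsto> ?c = ?c"
    using imp_imp[of x ?c ?c] imp_imp[of x x \<one>] mult_imp_one_and_one_imp(1)[OF x] x c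
    by (simp add: imp_refl)
  then show ?thesis using a[OF c] imp_refl[OF c] by simp
qed

declare imp_closed [simp, intro]

lemma le_refl [simp]: "x \<in> carrier A \<Longrightarrow> x \<preceq> x"
  by (simp add: hoop_le_def imp_refl)

lemma le_one [simp]: "x \<in> carrier A \<Longrightarrow> x \<preceq> \<one>"
  by (simp add: hoop_le_def)

lemma one_le_iff: "x \<in> carrier A \<Longrightarrow> \<one> \<preceq> x \<longleftrightarrow> x = \<one>"
  by (simp add: hoop_le_def)

lemma mult_imp_of_le: "\<lbrakk>b \<preceq> a; a \<in> carrier A; b \<in> carrier A\<rbrakk> \<Longrightarrow> a \<otimes> (a \<leadsto> b) = b"
  using divisibility[of a b] by (simp add: hoop_le_def)

lemma le_antisym: "\<lbrakk>a \<preceq> b; b \<preceq> a; a \<in> carrier A; b \<in> carrier A\<rbrakk> \<Longrightarrow> a = b"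
  using divisibility[of a b] by (simp add: hoop_le_def)

lemma le_trans:
  assumes "a \<preceq> b" "b \<preceq> c" "a \<in> carrier A" "b \<in> carrier A" "c \<in> carrier A"
  shows "a \<preceq> c"
proof -
  have "a \<leadsto> c = (b \<leadsto> a) \<otimes> b \<leadsto> c"
    using mult_imp_of_le[of a b] assms by (simp add: m_comm)
  also have "\<dots> = \<one>"
    using imp_imp[of "b \<leadsto> a" b c] assms by (simp add: hoop_le_def)
  finally show ?thesis by (simp add: hoop_le_def)
qed

lemma residuation:
  "\<lbrakk>a \<in> carrier A; b \<in> carrier A; c \<in> carrier A\<rbrakk> \<Longrightarrow> a \<otimes> b \<preceq> c \<longleftrightarrow> a \<preceq> b \<leadsto> c"
  by (simp add: hoop_le_def imp_imp)

lemma imp_swap: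
  "\<lbrakk>a \<in> carrier A; b \<in> carrier A; c \<in> carrier A\<rbrakk> \<Longrightarrow> a \<leadsto> (b \<leadsto> c) = b \<leadsto> (a \<leadsto> c)"
  by (simp add: imp_imp m_comm)

lemma mult_imp_le: "\<lbrakk>a \<in> carrier A; b \<in> carrier A\<rbrakk> \<Longrightarrow> (a \<leadsto> b) \<otimes> a \<preceq> b"
  by (simp add: residuation)

lemma mult_mono_left:
  assumes "a \<preceq> b" and [simp]: "a \<in> carrier A" "b \<in> carrier A" "c \<in> carrier A"
  shows "a \<otimes> c \<preceq> b \<otimes> c"
proof -
  have "b \<preceq> c \<leadsto> b \<otimes> c" using residuation[of b c "b \<otimes> c"] by simp
  then have "a \<preceq> c \<leadsto> b \<otimes> c" using le_trans[OF assms(1)] by simp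
  then show ?thesis by (simp add: residuation)
qed

lemma mult_le_left: "\<lbrakk>a \<in> carrier A; b \<in> carrier A\<rbrakk> \<Longrightarrow> a \<otimes> b \<preceq> b"
  by (simp add: residuation imp_refl)

lemma mult_le_right: "\<lbrakk>a \<in> carrier A; b \<in> carrier A\<rbrakk> \<Longrightarrow> a \<otimes> b \<preceq> a"
  using mult_le_left[of b a] by (simp add: m_comm)

lemma le_imp: "\<lbrakk>a \<in> carrier A; b \<in> carrier A\<rbrakk> \<Longrightarrow> b \<preceq> a \<leadsto> b"
  using residuation[of b a b] mult_le_right[of b a] by simp

lemma imp_mult_mono:
  "\<lbrakk>a \<in> carrier A; b \<in> carrier A; c \<in> carrier A\<rbrakk> \<Longrightarrow> a \<leadsto> b \<preceq> a \<otimes> c \<leadsto> b \<otimes> c"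
  using mult_mono_left[OF mult_imp_le[of a b], of c]
  by (simp add: residuation[symmetric] m_assoc)

lemma imp_mono_right:
  assumes [simp]: "a \<in> carrier A" "b \<in> carrier A" "c \<in> carrier A"
  shows "a \<leadsto> b \<preceq> (c \<leadsto> a) \<leadsto> (c \<leadsto> b)"
proof -
  have "(a \<leadsto> b) \<otimes> ((c \<leadsto> a) \<otimes> c) \<preceq> (a \<leadsto> b) \<otimes> a"
    using mult_mono_left[OF mult_imp_le[of c a], of "a \<leadsto> b"] by (simp add: m_comm)
  then have "(a \<leadsto> b) \<otimes> ((c \<leadsto> a) \<otimes> c) \<preceq> b"
    using le_trans[OF _ mult_imp_le[of a b]] by simp
  then show ?thesis by (simp add: residuation[symmetric] m_assoc)
qed

lemma imp_mono_left:
  assumes [simp]: "a \<in> carrier A" "b \<in> carrier A" "c \<in> carrier A"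
  shows "a \<leadsto> b \<preceq> (b \<leadsto> c) \<leadsto> (a \<leadsto> c)"
  using imp_mono_right[of b c a] residuation[of "a \<leadsto> b" "b \<leadsto> c" "a \<leadsto> c"]
    residuation[of "b \<leadsto> c" "a \<leadsto> b" "a \<leadsto> c"]
  by (simp add: m_comm)

lemma imp_le_imp_left:
  "\<lbrakk>a \<preceq> b; a \<in> carrier A; b \<in> carrier A; c \<in> carrier A\<rbrakk> \<Longrightarrow> b \<leadsto> c \<preceq> a \<leadsto> c"
  using imp_mono_left[of a b c] by (simp add: hoop_le_def)

lemma pow_le_pow:
  assumes "m \<le> n" "a \<in> carrier A"
  shows "a [^] n \<preceq> a [^] (m :: nat)"
proof -
  have "a [^] n = a [^] m \<otimes> a [^] (n - m)"
    using assms by (simp add: nat_pow_mult)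
  then show ?thesis using assms by (simp add: mult_le_right)
qed

lemma term_op_closed [simp]: "x \<in> carrier A \<Longrightarrow> term_op A t x \<in> carrier A"
  by (induction t) auto

end

section \<open>Prelinearity in Wajsberg hoops, and cancellation in chains\<close>

context wajsberg_hoop
begin

lemma imp_imp_of_le: "\<lbrakk>b \<preceq> a; a \<in> carrier A; b \<in> carrier A\<rbrakk> \<Longrightarrow> (a \<leadsto> b) \<leadsto> b = a"
  using wajsberg[of a b] by (simp add: hoop_le_def)

text \<open>The meet of \<open>a\<close> and \<open>b\<close> is \<open>m\<close>, so
  \<open>a \<leadsto> b = a \<leadsto> m\<close> and \<open>b \<leadsto> a = b \<leadsto> m\<close>.
  After exchanging premises, the Wajsberg law collapses \<open>(a \<leadsto> m) \<leadsto> m\<close>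
  to \<open>a\<close>.\<close>

lemma prelinearity:
  assumes [simp]: "a \<in> carrier A" "b \<in> carrier A"
  shows "(a \<leadsto> b) \<leadsto> (b \<leadsto> a) = b \<leadsto> a"
proof -
  define m where "m = a \<otimes> (a \<leadsto> b)"
  have [simp]: "m \<in> carrier A" by (simp add: m_def)
  have am: "a \<leadsto> m = a \<leadsto> b"
  proof (rule le_antisym)
    show "a \<leadsto> m \<preceq> a \<leadsto> b"
      using imp_mono_right[of m b a] mult_imp_le[of a b] by (simp add: hoop_le_def m_def m_comm)
    show "a \<leadsto> b \<preceq> a \<leadsto> m"
      using residuation[of "a \<leadsto> b" a m] by (simp add: m_def m_comm)
  qed auto
  have bm: "b \<leadsto> m = b \<leadsto> a"
  proof (rule le_antisym)
    show "b \<leadsto> m \<preceq> b \<leadsto> a"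
      using imp_mono_right[of m a b] mult_le_right[of a "a \<leadsto> b"] by (simp add: hoop_le_def m_def)
    show "b \<leadsto> a \<preceq> b \<leadsto> m"
      using residuation[of "b \<leadsto> a" b m] divisibility[of a b] by (simp add: m_def m_comm)
  qed auto
  have "(a \<leadsto> b) \<leadsto> (b \<leadsto> m) = b \<leadsto> ((a \<leadsto> m) \<leadsto> m)"
    using imp_swap[of "a \<leadsto> b" b m] am by simp
  also have "\<dots> = b \<leadsto> a"
    using imp_imp_of_le[of m a] mult_le_right[of a "a \<leadsto> b"] by (simp add: m_def)
  finally show ?thesis by (simp add: bm)
qed

lemma imp_eq_swap:
  assumes [simp]: "p \<in> carrier A" "q \<in> carrier A" and "p \<leadsto> q = q"
  shows "q \<leadsto> p = p"
proof (rule le_antisym)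
  show "q \<leadsto> p \<preceq> p" using wajsberg[of p q] assms(3) by (simp add: hoop_le_def imp_refl)
qed (simp_all add: le_imp)

text \<open>In a Wajsberg hoop the equation \<open>p \<leadsto> q = q\<close> says that the join of
  \<open>p\<close> and \<open>q\<close> is \<open>\<one>\<close>. Together with
  \<open>imp_eq_swap\<close>, this lemma passes it to powers of both elements.\<close>

lemma pow_imp_eq:
  assumes [simp]: "p \<in> carrier A" "q \<in> carrier A" and "p \<leadsto> q = q"
  shows "p [^] (n :: nat) \<leadsto> q = q"
  by (induction n) (simp_all add: imp_imp[symmetric] assms)

end

locale wajsberg_chain = wajsberg_hoop +
  assumes linear: "\<lbrakk>x \<in> carrier A; y \<in> carrier A\<rbrakk> \<Longrightarrow> x \<preceq> y \<or> y \<preceq> x"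
begin

text \<open>Any \<open>w\<close> with \<open>a \<otimes> w = a \<otimes> b\<close> can be recovered
  from \<open>a\<close>, \<open>a \<otimes> b\<close> and \<open>z\<close>: linearity puts
  \<open>w \<leadsto> z\<close> below \<open>a\<close>, so it equals
  \<open>a \<otimes> (a \<otimes> b \<leadsto> z)\<close>, and a second implication into
  \<open>z\<close> returns \<open>w\<close>. Both \<open>b\<close> and
  \<open>a \<leadsto> a \<otimes> b\<close> are such a \<open>w\<close>.\<close>

lemma imp_mult_cancel:
  assumes [simp]: "a \<in> carrier A" "b \<in> carrier A" "z \<in> carrier A" and nz: "\<not> a \<otimes> b \<preceq> z"
  shows "a \<leadsto> a \<otimes> b = b"
proof -
  let ?c = "a \<leadsto> a \<otimes> b"
  have z: "z \<preceq> a \<otimes> b" using linear[of z "a \<otimes> b"] nz by simp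
  have ac: "a \<otimes> ?c = a \<otimes> b" by (rule mult_imp_of_le) (simp_all add: mult_le_right)
  have *: "w = (a \<otimes> (a \<otimes> b \<leadsto> z)) \<leadsto> z" if [simp]: "w \<in> carrier A" and w: "a \<otimes> w = a \<otimes> b" for w
  proof -
    have "\<not> a \<preceq> w \<leadsto> z" using nz residuation[of a w z] w by simp
    then have "w \<leadsto> z \<preceq> a" using linear[of a "w \<leadsto> z"] by simp
    then have "a \<otimes> (a \<leadsto> (w \<leadsto> z)) = w \<leadsto> z" by (simp add: mult_imp_of_le)
    then have eq: "a \<otimes> (a \<otimes> b \<leadsto> z) = w \<leadsto> z" using w by (simp add: imp_imp)
    have "z \<preceq> w" using le_trans[OF z, of w] mult_le_left[of a w] w by simp
    then show ?thesis unfolding eq by (simp add: imp_imp_of_le)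
  qed
  show ?thesis using *[of ?c] *[of b] ac by simp
qed

end

section \<open>Homomorphisms, quotients and transport\<close>

definition hoop_hom :: "('a, 'm) hoop_scheme \<Rightarrow> ('b, 'n) hoop_scheme \<Rightarrow> ('a \<Rightarrow> 'b) \<Rightarrow> bool"
  where "hoop_hom A B h \<longleftrightarrow>
    h \<in> carrier A \<rightarrow> carrier B \<and> h \<one>\<^bsub>A\<^esub> = \<one>\<^bsub>B\<^esub> \<and>
    (\<forall>x\<in>carrier A. \<forall>y\<in>carrier A. h (x \<otimes>\<^bsub>A\<^esub> y) = h x \<otimes>\<^bsub>B\<^esub> h y) \<and>
    (\<forall>x\<in>carrier A. \<forall>y\<in>carrier A. h (x \<leadsto>\<^bsub>A\<^esub> y) = h x \<leadsto>\<^bsub>B\<^esub> h y)"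

lemma term_op_hom:
  assumes "hoop A" "hoop_hom A B h" "x \<in> carrier A"
  shows "term_op B t (h x) = h (term_op A t x)"
proof -
  interpret hoop A by fact
  show ?thesis using assms(2,3) by (induction t) (auto simp: hoop_hom_def)
qed

text \<open>The axioms are closure conditions and equations, so they pass to images. Since
  \<open>B\<close> is not assumed to be a hoop, this serves both for copying a hoop along an
  injection and for forming a quotient.\<close>

lemma wajsberg_hoop_image:
  fixes A :: "('a, 'm) hoop_scheme" (structure)
  assumes "wajsberg_hoop A" "hoop_hom A B h" "carrier B = h ` carrier A"
  shows "wajsberg_hoop B"
proof -
  interpret wajsberg_hoop A by fact
  have h1: "\<one>\<^bsub>B\<^esub> = h \<one>"
    and hm: "\<And>x y. \<lbrakk>x \<in> carrier A; y \<in> carrier A\<rbrakk> \<Longrightarrow> h x \<otimes>\<^bsub>B\<^esub> h y = h (x \<otimes> y)"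
    and hi: "\<And>x y. \<lbrakk>x \<in> carrier A; y \<in> carrier A\<rbrakk> \<Longrightarrow> h x \<leadsto>\<^bsub>B\<^esub> h y = h (x \<leadsto> y)"
    using assms(2) by (auto simp: hoop_hom_def)
  show ?thesis
  proof unfold_locales
    show "\<one>\<^bsub>B\<^esub> \<in> carrier B" by (simp add: h1 assms(3))
  next
    fix x y z assume "x \<in> carrier B" "y \<in> carrier B" "z \<in> carrier B"
    then obtain a b c where [simp]: "a \<in> carrier A" "b \<in> carrier A" "c \<in> carrier A"
      and [simp]: "x = h a" "y = h b" "z = h c" using assms(3) by auto
    show "x \<otimes>\<^bsub>B\<^esub> y \<otimes>\<^bsub>B\<^esub> z = x \<otimes>\<^bsub>B\<^esub> (y \<otimes>\<^bsub>B\<^esub> z)" by (simp add: hm m_assoc)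
    show "x \<leadsto>\<^bsub>B\<^esub> y \<leadsto>\<^bsub>B\<^esub> z = (x \<otimes>\<^bsub>B\<^esub> y) \<leadsto>\<^bsub>B\<^esub> z" by (simp add: hm hi imp_imp)
  next
    fix x y assume "x \<in> carrier B" "y \<in> carrier B"
    then obtain a b where [simp]: "a \<in> carrier A" "b \<in> carrier A"
      and [simp]: "x = h a" "y = h b" using assms(3) by auto
    show "x \<otimes>\<^bsub>B\<^esub> y \<in> carrier B" "x \<leadsto>\<^bsub>B\<^esub> y \<in> carrier B"
      by (simp_all add: hm hi assms(3))
    show "x \<otimes>\<^bsub>B\<^esub> y = y \<otimes>\<^bsub>B\<^esub> x" by (simp add: hm m_comm)
    show "x \<otimes>\<^bsub>B\<^esub> (x \<leadsto>\<^bsub>B\<^esub> y) = y \<otimes>\<^bsub>B\<^esub> (y \<leadsto>\<^bsub>B\<^esub> x)"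
      by (simp add: hm hi divisibility)
    show "(x \<leadsto>\<^bsub>B\<^esub> y) \<leadsto>\<^bsub>B\<^esub> y = (y \<leadsto>\<^bsub>B\<^esub> x) \<leadsto>\<^bsub>B\<^esub> x"
      by (simp add: hi wajsberg)
  next
    fix x assume "x \<in> carrier B"
    then obtain a where [simp]: "a \<in> carrier A" and [simp]: "x = h a" using assms(3) by auto
    show "\<one>\<^bsub>B\<^esub> \<otimes>\<^bsub>B\<^esub> x = x" "x \<otimes>\<^bsub>B\<^esub> \<one>\<^bsub>B\<^esub> = x" "x \<leadsto>\<^bsub>B\<^esub> x = \<one>\<^bsub>B\<^esub>"
      by (simp_all add: hm hi h1 imp_refl)
  qed
qed

text \<open>The hypothesis on \<open>t\<close> speaks only of hoops over the universe
  \<open>'a\<close>. A hoop over another type is copied into \<open>'a\<close> along an injection;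
  this will be applied to \<open>nat_hoop\<close> and to intervals of the cover.\<close>

lemma conucleus_transport:
  fixes A :: "('b, 'm) hoop_scheme" (structure) and f :: "'b \<Rightarrow> 'a"
  assumes con: "conucleus_term_on (WH :: 'a hoop set) t"
    and A: "wajsberg_hoop A" and inj: "inj_on f (carrier A)"
  shows "conucleus A (term_op A t)"
proof -
  interpret wajsberg_hoop A by fact
  define g where "g = inv_into (carrier A) f"
  define B :: "'a hoop" where "B = \<lparr>carrier = f ` carrier A,
    monoid.mult = (\<lambda>x y. f (g x \<otimes> g y)), one = f \<one>, himp = (\<lambda>x y. f (g x \<leadsto> g y))\<rparr>"
  have gf [simp]: "g (f x) = x" if "x \<in> carrier A" for x
    using that inj by (simp add: g_def)
  have hom: "hoop_hom A B f" by (simp add: hoop_hom_def B_def)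
  have B: "wajsberg_hoop B" by (rule wajsberg_hoop_image[OF A hom]) (simp add: B_def)
  then interpret C: conucleus B "term_op B t"
    using con by (simp add: conucleus_term_on_def WH_def)
  have t: "term_op B t (f x) = f (term_op A t x)" if "x \<in> carrier A" for x
    using term_op_hom[OF hoop_axioms hom that] .
  have fB: "f x \<in> carrier B" if "x \<in> carrier A" for x using that by (simp add: B_def)
  have eq: "f x = f y \<longleftrightarrow> x = y" if "x \<in> carrier A" "y \<in> carrier A" for x y
    using inj that by (auto dest: inj_onD)
  have le: "f x \<preceq>\<^bsub>B\<^esub> f y \<longleftrightarrow> x \<preceq> y" if "x \<in> carrier A" "y \<in> carrier A" for x y
    using that by (simp add: hoop_le_def B_def eq)
  have mult: "f x \<otimes>\<^bsub>B\<^esub> f y = f (x \<otimes> y)" if "x \<in> carrier A" "y \<in> carrier A" for x y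
    using that by (simp add: B_def)
  have one: "\<one>\<^bsub>B\<^esub> = f \<one>" by (simp add: B_def)
  show ?thesis
  proof unfold_locales
    fix a assume a: "a \<in> carrier A"
    then show "term_op A t a \<in> carrier A" by simp
    show "term_op A t a \<preceq> a" using C.contracting[OF fB[OF a]] a by (simp add: t le)
    show "term_op A t (term_op A t a) = term_op A t a"
      using C.idempotent[OF fB[OF a]] a by (simp add: t eq)
    show "term_op A t a \<otimes> term_op A t \<one> = term_op A t a"
      using C.mult_top[OF fB[OF a]] a by (simp add: t eq mult one)
    fix b assume b: "b \<in> carrier A"
    show "term_op A t a \<otimes> term_op A t b \<preceq> term_op A t (a \<otimes> b)"
      using C.submultiplicative[OF fB[OF a] fB[OF b]] a b by (simp add: t le mult)
    assume "a \<preceq> b"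
    then show "term_op A t a \<preceq> term_op A t b"
      using C.monotone[OF fB[OF a] fB[OF b]] a b by (simp add: t le)
  qed
qed

section \<open>Deductive filters and chain quotients\<close>

definition (in hoop) deductive_filter :: "'a set \<Rightarrow> bool"
  where "deductive_filter F \<longleftrightarrow> F \<subseteq> carrier A \<and> \<one> \<in> F \<and>
    (\<forall>a\<in>F. \<forall>b\<in>carrier A. a \<leadsto> b \<in> F \<longrightarrow> b \<in> F)"

context hoop
begin

lemma filter_mp:
  "\<lbrakk>deductive_filter F; a \<in> F; a \<leadsto> b \<in> F; b \<in> carrier A\<rbrakk> \<Longrightarrow> b \<in> F"
  unfolding deductive_filter_def by blast

lemma filter_upward:
  "\<lbrakk>deductive_filter F; a \<in> F; a \<preceq> b; b \<in> carrier A\<rbrakk> \<Longrightarrow> b \<in> F"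
  by (auto simp: deductive_filter_def hoop_le_def)

lemma filter_mult:
  assumes F: "deductive_filter F" and ab: "a \<in> F" "b \<in> F"
  shows "a \<otimes> b \<in> F"
proof -
  have [simp]: "a \<in> carrier A" "b \<in> carrier A" using assms by (auto simp: deductive_filter_def)
  have "a \<preceq> b \<leadsto> a \<otimes> b" using residuation[of a b "a \<otimes> b"] by simp
  then have "b \<leadsto> a \<otimes> b \<in> F" by (rule filter_upward[OF F ab(1)]) simp
  then show ?thesis using filter_mp[OF F ab(2)] by simp
qed

text \<open>This is the filter generated by \<open>F\<close> and \<open>p\<close>; under modus
  ponens the exponents of \<open>p\<close> add up.\<close>

lemma deductive_filter_adjoin:
  assumes F: "deductive_filter F" and p [simp]: "p \<in> carrier A"
  shows "deductive_filter {b \<in> carrier A. \<exists>n :: nat. p [^] n \<leadsto> b \<in> F}" (is "deductive_filter ?G")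
  unfolding deductive_filter_def
proof (intro conjI ballI impI)
  show "?G \<subseteq> carrier A" "\<one> \<in> ?G" using F by (auto simp: deductive_filter_def)
  fix a b assume "a \<in> ?G" and b [simp]: "b \<in> carrier A" and "a \<leadsto> b \<in> ?G"
  then obtain n m :: nat where a [simp]: "a \<in> carrier A"
    and n: "p [^] n \<leadsto> a \<in> F" and m: "p [^] m \<leadsto> (a \<leadsto> b) \<in> F" by auto
  have "p [^] m \<leadsto> (a \<leadsto> b) = a \<leadsto> (p [^] m \<leadsto> b)" by (simp add: imp_swap)
  also have "\<dots> \<preceq> (p [^] n \<leadsto> a) \<leadsto> (p [^] n \<leadsto> (p [^] m \<leadsto> b))"
    by (rule imp_mono_right) auto
  also have "p [^] n \<leadsto> (p [^] m \<leadsto> b) = p [^] (n + m) \<leadsto> b"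
    by (simp add: imp_imp nat_pow_mult)
  finally have "(p [^] n \<leadsto> a) \<leadsto> (p [^] (n + m) \<leadsto> b) \<in> F"
    by (rule filter_upward[OF F m]) simp
  then have "p [^] (n + m) \<leadsto> b \<in> F" using filter_mp[OF F n] by simp
  then show "b \<in> ?G" by auto
qed

end

context wajsberg_hoop
begin

text \<open>A filter maximal among those avoiding \<open>c\<close> is prime. The quotient by it will
  be a chain in which \<open>c\<close> stays different from \<open>\<one>\<close>.\<close>

lemma exists_prime_filter:
  assumes c [simp]: "c \<in> carrier A" and "c \<noteq> \<one>"
  obtains F where "deductive_filter F" "c \<notin> F"
    "\<forall>a\<in>carrier A. \<forall>b\<in>carrier A. a \<leadsto> b \<in> F \<or> b \<leadsto> a \<in> F"
proof -
  let ?S = "{F. deductive_filter F \<and> c \<notin> F}"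
  have "{\<one>} \<in> ?S" using assms by (auto simp: deductive_filter_def)
  then have "?S \<noteq> {}" by blast
  then have "\<exists>F\<in>?S. \<forall>X\<in>?S. F \<subseteq> X \<longrightarrow> X = F"
  proof (rule subset_Zorn_nonempty)
    fix \<C> assume ne: "\<C> \<noteq> {}" and ch: "subset.chain ?S \<C>"
    have S: "deductive_filter F \<and> c \<notin> F" if "F \<in> \<C>" for F
      using ch that by (auto simp: subset.chain_def)
    have "deductive_filter (\<Union>\<C>)" unfolding deductive_filter_def
    proof (intro conjI ballI impI)
      show "\<Union>\<C> \<subseteq> carrier A" "\<one> \<in> \<Union>\<C>"
        using S ne by (auto simp: deductive_filter_def)
      fix a b assume "a \<in> \<Union>\<C>" and b: "b \<in> carrier A" and "a \<leadsto> b \<in> \<Union>\<C>"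
      then obtain X Y where X: "X \<in> \<C>" "a \<in> X" and Y: "Y \<in> \<C>" "a \<leadsto> b \<in> Y" by blast
      have "X \<subseteq> Y \<or> Y \<subseteq> X" using ch X(1) Y(1) by (auto simp: subset_chain_def)
      then obtain Z where "Z \<in> \<C>" "a \<in> Z" "a \<leadsto> b \<in> Z" using X Y by blast
      then show "b \<in> \<Union>\<C>" using S[of Z] b unfolding deductive_filter_def by blast
    qed
    then show "\<Union>\<C> \<in> ?S" using S by auto
  qed
  then obtain F where F: "deductive_filter F" and cF: "c \<notin> F"
    and max: "\<And>X. \<lbrakk>deductive_filter X; c \<notin> X; F \<subseteq> X\<rbrakk> \<Longrightarrow> X = F" by auto
  \<comment> \<open>By maximality, adjoining any \<open>p\<close> outside \<open>F\<close> must
    capture \<open>c\<close>.\<close>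
  have power: "\<exists>n :: nat. p [^] n \<leadsto> c \<in> F" if p [simp]: "p \<in> carrier A" and pF: "p \<notin> F" for p
  proof (rule ccontr)
    assume no: "\<not> ?thesis"
    let ?G = "{b \<in> carrier A. \<exists>n :: nat. p [^] n \<leadsto> b \<in> F}"
    have "F \<subseteq> ?G"
    proof
      fix b assume b: "b \<in> F"
      then have [simp]: "b \<in> carrier A" using F by (auto simp: deductive_filter_def)
      have "p [^] (0 :: nat) \<leadsto> b \<in> F" using b by simp
      then show "b \<in> ?G" using \<open>b \<in> carrier A\<close> by blast
    qed
    then have "?G = F" using max deductive_filter_adjoin[OF F p] no by blast
    moreover have "p [^] (1 :: nat) \<leadsto> p \<in> F"
      using F by (simp add: imp_refl deductive_filter_def)
    then have "p \<in> ?G" using p by blast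
    ultimately show False using pF by blast
  qed
  have "a \<leadsto> b \<in> F \<or> b \<leadsto> a \<in> F" if [simp]: "a \<in> carrier A" "b \<in> carrier A" for a b
  proof (rule ccontr)
    assume "\<not> ?thesis"
    then have "a \<leadsto> b \<notin> F" "b \<leadsto> a \<notin> F" by auto
    then obtain n m :: nat where n: "(a \<leadsto> b) [^] n \<leadsto> c \<in> F" and m: "(b \<leadsto> a) [^] m \<leadsto> c \<in> F"
      using power[of "a \<leadsto> b"] power[of "b \<leadsto> a"] by auto
    define P Q where "P = (a \<leadsto> b) [^] n" and "Q = (b \<leadsto> a) [^] m"
    have [simp]: "P \<in> carrier A" "Q \<in> carrier A" by (simp_all add: P_def Q_def)
    have "P \<leadsto> (b \<leadsto> a) = b \<leadsto> a"
      \<comment> \<open>Prelinearity supplies the equation \<open>p \<leadsto> q = q\<close> for the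
        two implications; it survives taking powers in one argument and then, after a swap, in the
        other.\<close>
      unfolding P_def using pow_imp_eq prelinearity by simp
    then have QP: "Q \<leadsto> P = P"
      unfolding Q_def using pow_imp_eq imp_eq_swap[of P "b \<leadsto> a"] by simp
    \<comment> \<open>The element \<open>h\<close> lies in \<open>F\<close> and puts both
      \<open>P\<close> and \<open>Q\<close> below \<open>h \<leadsto> c\<close>. Since
      \<open>Q \<leadsto> P = P\<close>, the only common upper bound of \<open>P\<close> and
      \<open>Q\<close> is \<open>\<one>\<close>; hence \<open>h \<preceq> c\<close>.\<close>
    define h where "h = (P \<leadsto> c) \<otimes> (Q \<leadsto> c)"
    have hF: "h \<in> F" unfolding h_def P_def Q_def by (rule filter_mult[OF F n m])
    have [simp]: "h \<in> carrier A" by (simp add: h_def)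
    let ?d = "h \<leadsto> c"
    have Pd: "P \<preceq> ?d" and Qd: "Q \<preceq> ?d"
      using mult_le_right[of "P \<leadsto> c" "Q \<leadsto> c"] mult_le_left[of "P \<leadsto> c" "Q \<leadsto> c"]
        imp_swap[of h P c] imp_swap[of h Q c]
      by (simp_all add: h_def[symmetric] hoop_le_def)
    have "?d \<leadsto> P \<preceq> P" using imp_le_imp_left[OF Qd, of P] QP by simp
    then have "(P \<leadsto> ?d) \<leadsto> ?d = \<one>" using wajsberg[of ?d P] by (simp add: hoop_le_def)
    then have "?d = \<one>" using Pd by (simp add: hoop_le_def)
    then have "c \<in> F" using filter_upward[OF F hF, of c] by (simp add: hoop_le_def)
    then show False using cF by simp
  qed
  then show ?thesis using that F cF by blast
qed

lemma exists_chain_quotient: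
  assumes c: "c \<in> carrier A" "c \<noteq> \<one>"
  obtains C :: "'a hoop" and h where "wajsberg_chain C" "hoop_hom A C h" "h c \<noteq> \<one>\<^bsub>C\<^esub>"
proof -
  obtain F where F: "deductive_filter F" and cF: "c \<notin> F"
    and prime: "\<forall>a\<in>carrier A. \<forall>b\<in>carrier A. a \<leadsto> b \<in> F \<or> b \<leadsto> a \<in> F"
    by (rule exists_prime_filter[OF c])
  define eqv where "eqv a b \<longleftrightarrow> a \<leadsto> b \<in> F \<and> b \<leadsto> a \<in> F" for a b
  have oneF: "\<one> \<in> F" using F by (simp add: deductive_filter_def)
  have mp: "b \<in> F" if "a \<in> F" "a \<leadsto> b \<in> F" "b \<in> carrier A" for a b
    using F that unfolding deductive_filter_def by blast
  have up: "\<And>a b. \<lbrakk>a \<in> F; a \<preceq> b; b \<in> carrier A\<rbrakk> \<Longrightarrow> b \<in> F"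
    using filter_upward[OF F] .
  have trans: "a \<leadsto> d \<in> F" if "a \<leadsto> b \<in> F" "b \<leadsto> d \<in> F"
    and [simp]: "a \<in> carrier A" "b \<in> carrier A" "d \<in> carrier A" for a b d
  proof -
    have "(a \<leadsto> b) \<leadsto> (a \<leadsto> d) \<in> F" using up[OF that(2) imp_mono_right] by simp
    then show ?thesis using mp[OF that(1)] by simp
  qed
  have refl: "eqv a a" if "a \<in> carrier A" for a
    using that oneF by (simp add: eqv_def imp_refl)
  have sym: "eqv a b \<Longrightarrow> eqv b a" for a b by (simp add: eqv_def)
  have eqv_trans: "eqv a d" if "eqv a b" "eqv b d" "a \<in> carrier A" "b \<in> carrier A" "d \<in> carrier A"
    for a b d using that trans[of a b d] trans[of d b a] unfolding eqv_def by simp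
  have eqv_mult1: "eqv (a \<otimes> d) (b \<otimes> d)"
    if "eqv a b" "a \<in> carrier A" "b \<in> carrier A" "d \<in> carrier A" for a b d
    using that up[OF _ imp_mult_mono[of a b d]] up[OF _ imp_mult_mono[of b a d]]
    unfolding eqv_def by simp
  have eqv_mult: "eqv (a \<otimes> a') (b \<otimes> b')"
    if "eqv a b" "eqv a' b'" "a \<in> carrier A" "b \<in> carrier A" "a' \<in> carrier A" "b' \<in> carrier A"
    for a b a' b'
    using eqv_trans[OF eqv_mult1[of a b a'], of "b \<otimes> b'"] eqv_mult1[of a' b' b] that
    by (simp add: m_comm)
  have eqv_imp: "eqv (a \<leadsto> a') (b \<leadsto> b')"
    if "eqv a b" "eqv a' b'" "a \<in> carrier A" "b \<in> carrier A" "a' \<in> carrier A" "b' \<in> carrier A"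
    for a b a' b'
  proof (rule eqv_trans)
    show "eqv (a \<leadsto> a') (b \<leadsto> a')"
      using that up[of _ "(a \<leadsto> a') \<leadsto> (b \<leadsto> a')"] up[of _ "(b \<leadsto> a') \<leadsto> (a \<leadsto> a')"]
        imp_mono_left[of a b a'] imp_mono_left[of b a a'] unfolding eqv_def by auto
    show "eqv (b \<leadsto> a') (b \<leadsto> b')"
      using that up[of _ "(b \<leadsto> a') \<leadsto> (b \<leadsto> b')"] up[of _ "(b \<leadsto> b') \<leadsto> (b \<leadsto> a')"]
        imp_mono_right[of a' b' b] imp_mono_right[of b' a' b] unfolding eqv_def by auto
  qed (use that in auto)
  \<comment> \<open>Each class is represented by one chosen member, so the quotient lives on the
    same type and remains subject to hypotheses about \<open>WH\<close>.\<close>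
  define h where "h a = (SOME b. b \<in> carrier A \<and> eqv a b)" for a
  have h: "h a \<in> carrier A" "eqv a (h a)" if "a \<in> carrier A" for a
    using someI[of "\<lambda>b. b \<in> carrier A \<and> eqv a b" a] that refl[OF that] by (auto simp: h_def)
  have h_eq: "h a = h b \<longleftrightarrow> eqv a b" if ab: "a \<in> carrier A" "b \<in> carrier A" for a b
  proof
    assume "h a = h b"
    then show "eqv a b" using eqv_trans[of a "h a" b] sym h ab by metis
  next
    assume "eqv a b"
    then have "d \<in> carrier A \<and> eqv a d \<longleftrightarrow> d \<in> carrier A \<and> eqv b d" for d
      using eqv_trans ab sym by blast
    then show "h a = h b" by (simp add: h_def)
  qed
  define C :: "'a hoop" where "C = \<lparr>carrier = h ` carrier A,
    monoid.mult = (\<lambda>x y. h (x \<otimes> y)), one = h \<one>, himp = (\<lambda>x y. h (x \<leadsto> y))\<rparr>"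
  have hom: "hoop_hom A C h"
    using h by (auto simp: hoop_hom_def C_def h_eq intro!: eqv_mult eqv_imp)
  interpret C: wajsberg_hoop C
    by (rule wajsberg_hoop_image[OF wajsberg_hoop_axioms hom]) (simp add: C_def)
  have h_one: "h a = \<one>\<^bsub>C\<^esub> \<longleftrightarrow> a \<in> F" if "a \<in> carrier A" for a
    using that oneF by (simp add: C_def h_eq eqv_def)
  have "wajsberg_chain C"
  proof unfold_locales
    fix x y assume "x \<in> carrier C" "y \<in> carrier C"
    then obtain a b where [simp]: "a \<in> carrier A" "b \<in> carrier A" and xy: "x = h a" "y = h b"
      by (auto simp: C_def)
    show "x \<preceq>\<^bsub>C\<^esub> y \<or> y \<preceq>\<^bsub>C\<^esub> x"
    proof -
      have "h a \<leadsto>\<^bsub>C\<^esub> h b = h (a \<leadsto> b)" "h b \<leadsto>\<^bsub>C\<^esub> h a = h (b \<leadsto> a)"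
        using hom by (simp_all add: hoop_hom_def)
      then show ?thesis using prime by (simp add: hoop_le_def xy h_one)
    qed
  qed
  then show ?thesis by (rule that[OF _ hom]) (simp add: h_one c cF)
qed

end

section \<open>Terms at elements with many distinct powers\<close>

text \<open>The truncated difference is the value of an implication between powers in a cancellative chain.\<close>

primrec term_degree :: "hoop_term \<Rightarrow> nat" where
  "term_degree Var = 1"
| "term_degree Top = 0"
| "term_degree (Mult s t) = term_degree s + term_degree t"
| "term_degree (Imp s t) = term_degree t - term_degree s"

text \<open>Unlike \<open>term_degree\<close>, which can drop at an implication, this bounds the
  degrees of all subterms.\<close>

primrec var_count :: "hoop_term \<Rightarrow> nat" where
  "var_count Var = 1"
| "var_count Top = 0"
| "var_count (Mult s t) = var_count s + var_count t"
| "var_count (Imp s t) = var_count s + var_count t"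

lemma term_degree_le: "term_degree t \<le> var_count t"
  by (induction t) auto

text \<open>The powers of \<open>y\<close> that arise as values of subterms have exponents at most
  \<open>var_count t\<close>, so none of them lies below \<open>z\<close>. There
  \<open>imp_mult_cancel\<close> applies, and implications between powers subtract
  exponents.\<close>

lemma (in wajsberg_chain) term_op_eq_pow:
  assumes y [simp]: "y \<in> carrier A" and z [simp]: "z \<in> carrier A"
    and "\<not> y [^] var_count t \<preceq> z"
  shows "term_op A t y = y [^] term_degree t"
  using assms(3)
proof (induction t)
  case (Mult s t)
  have "\<not> y [^] var_count s \<preceq> z" "\<not> y [^] var_count t \<preceq> z"
    using Mult.prems le_trans[OF pow_le_pow[of "var_count s" "var_count s + var_count t" y]]
      le_trans[OF pow_le_pow[of "var_count t" "var_count s + var_count t" y]] by auto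
  then show ?case using Mult.IH by (simp add: nat_pow_mult)
next
  case (Imp s t)
  have *: "\<not> y [^] var_count s \<preceq> z" "\<not> y [^] var_count t \<preceq> z"
    using Imp.prems le_trans[OF pow_le_pow[of "var_count s" "var_count s + var_count t" y]]
      le_trans[OF pow_le_pow[of "var_count t" "var_count s + var_count t" y]] by auto
  let ?m = "term_degree s" and ?n = "term_degree t"
  show ?case
  proof (cases "?n \<le> ?m")
    case True
    then show ?thesis using Imp.IH * pow_le_pow[OF True y] by (simp add: hoop_le_def)
  next
    case False
    then have n: "y [^] ?n = y [^] ?m \<otimes> y [^] (?n - ?m)" by (simp add: nat_pow_mult)
    have "\<not> y [^] ?n \<preceq> z"
      using * le_trans[OF pow_le_pow[OF term_degree_le[of t] y]] by auto
    then have "y [^] ?m \<leadsto> y [^] ?n = y [^] (?n - ?m)"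
      unfolding n by (intro imp_mult_cancel) auto
    then show ?thesis using Imp.IH * by simp
  qed
qed auto

text \<open>This is the negative cone of the integers in additive notation: the hoop order reverses
  the usual order, and 0 is the top.\<close>

definition nat_hoop :: "nat hoop"
  where "nat_hoop = \<lparr>carrier = UNIV, monoid.mult = (+), one = 0, himp = (\<lambda>m n. n - m)\<rparr>"

lemma nat_hoop: "wajsberg_hoop nat_hoop"
  by unfold_locales (auto simp: nat_hoop_def)

lemma term_op_nat_hoop: "term_op nat_hoop t n = term_degree t * n"
  by (induction t) (auto simp: nat_hoop_def algebra_simps diff_mult_distrib)

text \<open>On \<open>nat_hoop\<close> the term multiplies by its degree. At 1, contraction makes
  the degree at least 1, the order being reversed, and idempotence makes it equal to its
  square.\<close>

lemma conucleus_term_degree: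
  assumes "conucleus nat_hoop (term_op nat_hoop t)"
  shows "term_degree t = 1"
proof -
  interpret conucleus nat_hoop "term_op nat_hoop t" by fact
  have "1 \<le> term_degree t" "term_degree t * term_degree t = term_degree t"
    using contracting[of 1] idempotent[of 1]
    by (simp_all only: term_op_nat_hoop) (simp_all add: hoop_le_def nat_hoop_def)
  then show ?thesis by simp
qed

section \<open>Intervals of cancellative chains\<close>

text \<open>These monoids are the positive cones of linearly ordered abelian groups, with
  divisibility as the order.\<close>

locale divisibility_chain = comm_monoid_cancel M for M (structure) +
  assumes conical: "\<lbrakk>a \<otimes> b = \<one>; a \<in> carrier M; b \<in> carrier M\<rbrakk> \<Longrightarrow> a = \<one>"
    and divides_linear: "\<lbrakk>a \<in> carrier M; b \<in> carrier M\<rbrakk> \<Longrightarrow> a divides b \<or> b divides a"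

text \<open>
  The order of a hoop is the converse of divisibility, so the divisors of \<open>d\<close> form the interval
  from \<open>d\<close> to \<open>\<one>\<close>, and multiplication is truncated at \<open>d\<close>.
\<close>

definition interval_hoop :: "('a, 'm) monoid_scheme \<Rightarrow> 'a \<Rightarrow> 'a hoop"
  where "interval_hoop M d = \<lparr>carrier = {a \<in> carrier M. a divides\<^bsub>M\<^esub> d},
    monoid.mult = (\<lambda>a b. if (a \<otimes>\<^bsub>M\<^esub> b) divides\<^bsub>M\<^esub> d then a \<otimes>\<^bsub>M\<^esub> b else d),
    one = \<one>\<^bsub>M\<^esub>,
    himp = (\<lambda>a b. if a divides\<^bsub>M\<^esub> b then THE c. c \<in> carrier M \<and> b = a \<otimes>\<^bsub>M\<^esub> c else \<one>\<^bsub>M\<^esub>)\<rparr>"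

lemma interval_hoop_simps:
  "carrier (interval_hoop M d) = {a \<in> carrier M. a divides\<^bsub>M\<^esub> d}"
  "\<one>\<^bsub>interval_hoop M d\<^esub> = \<one>\<^bsub>M\<^esub>"
  "a \<otimes>\<^bsub>interval_hoop M d\<^esub> b = (if (a \<otimes>\<^bsub>M\<^esub> b) divides\<^bsub>M\<^esub> d then a \<otimes>\<^bsub>M\<^esub> b else d)"
  by (simp_all add: interval_hoop_def)

context divisibility_chain
begin

lemma one_divides [simp]: "a \<in> carrier M \<Longrightarrow> \<one> divides a"
  by (rule dividesI[of a]) simp_all

lemma divides_antisym:
  assumes "a divides b" "b divides a" and [simp]: "a \<in> carrier M" "b \<in> carrier M"
  shows "a = b"
proof -
  obtain c e where [simp]: "c \<in> carrier M" "e \<in> carrier M" and b: "b = a \<otimes> c" and a: "a = b \<otimes> e"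
    using assms by (auto elim!: dividesE)
  have "a \<otimes> \<one> = a \<otimes> (c \<otimes> e)" using a b by (simp add: m_assoc)
  then have "c \<otimes> e = \<one>" by (metis l_cancel \<open>c \<in> carrier M\<close> \<open>e \<in> carrier M\<close> assms(3) m_closed one_closed)
  then show ?thesis using conical[of c e] b by simp
qed

lemma interval_imp_eq:
  assumes "a \<otimes> c = b" "a \<in> carrier M" "c \<in> carrier M"
  shows "a \<leadsto>\<^bsub>interval_hoop M d\<^esub> b = c"
proof -
  have "(THE e. e \<in> carrier M \<and> b = a \<otimes> e) = c"
    using assms l_cancel by (intro the_equality) blast+
  moreover have "a divides b" using assms by (auto intro: dividesI)
  ultimately show ?thesis by (simp add: interval_hoop_def)
qed

lemma interval_imp_one:
  assumes "b divides a" "a \<in> carrier M" "b \<in> carrier M"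
  shows "a \<leadsto>\<^bsub>interval_hoop M d\<^esub> b = \<one>"
proof (cases "a divides b")
  case True
  then have "a = b" using divides_antisym assms by blast
  then show ?thesis using interval_imp_eq[of a \<one> b] assms by simp
qed (simp add: interval_hoop_def)

lemma interval_le_iff:
  assumes "a \<in> carrier M" "b \<in> carrier M"
  shows "a \<preceq>\<^bsub>interval_hoop M d\<^esub> b \<longleftrightarrow> b divides a"
proof (cases "b divides a")
  case True
  then show ?thesis using interval_imp_one[OF True assms]
    by (simp add: hoop_le_def interval_hoop_simps)
next
  case False
  then obtain c where c: "c \<in> carrier M" "b = a \<otimes> c"
    using divides_linear[OF assms] by (auto elim: dividesE)
  then have "a \<leadsto>\<^bsub>interval_hoop M d\<^esub> b = c" using interval_imp_eq assms by blast
  moreover have "c \<noteq> \<one>" using False c assms by auto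
  ultimately show ?thesis using False by (simp add: hoop_le_def interval_hoop_simps)
qed

lemma wajsberg_chain_interval:
  assumes d [simp]: "d \<in> carrier M"
  shows "wajsberg_chain (interval_hoop M d)"
proof -
  let ?D = "interval_hoop M d"
  have tr: "x divides z" if "x divides y" "y divides z" "x \<in> carrier M" for x y z
    using divides_trans that by blast
  have dvd_l: "x divides z" if "(x \<otimes> y) divides z" "x \<in> carrier M" "y \<in> carrier M" for x y z
    using tr[OF _ that(1)] divides_prod_r[of x x y] that by simp
  have not_dvd: "d divides x" if "\<not> x divides d" "x \<in> carrier M" for x
    using divides_linear[of d x] that by simp
  \<comment> \<open>Truncation at \<open>d\<close>. By \<open>T_mult\<close>, truncating an inner
    factor does not affect the truncated product, which gives associativity.\<close>
  define T where "T w = (if w divides d then w else d)" for w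
  have T_eq: "T w = d" if "d divides w" "w \<in> carrier M" for w
    using that divides_antisym[of d w] by (auto simp: T_def)
  have T_mult: "T (x \<otimes> T w) = T (x \<otimes> w)" if [simp]: "x \<in> carrier M" "w \<in> carrier M" for x w
  proof (cases "w divides d")
    case False
    then have "T (x \<otimes> d) = d" "T (x \<otimes> w) = d"
      using not_dvd by (simp_all add: T_eq divides_prod_l)
    then show ?thesis using False by (simp add: T_def)
  qed (simp add: T_def)
  show ?thesis
  proof unfold_locales
    show "\<one>\<^bsub>?D\<^esub> \<in> carrier ?D" by (simp add: interval_hoop_simps)
  next
    fix x assume "x \<in> carrier ?D"
    then have x [simp]: "x \<in> carrier M" "x divides d" by (auto simp: interval_hoop_simps)
    show "\<one>\<^bsub>?D\<^esub> \<otimes>\<^bsub>?D\<^esub> x = x" by (simp add: interval_hoop_simps)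
    show "x \<otimes>\<^bsub>?D\<^esub> \<one>\<^bsub>?D\<^esub> = x" by (simp add: interval_hoop_simps)
    show "x \<leadsto>\<^bsub>?D\<^esub> x = \<one>\<^bsub>?D\<^esub>" using interval_imp_one[of x x] by (simp add: interval_hoop_simps)
  next
    fix x y assume "x \<in> carrier ?D" "y \<in> carrier ?D"
    then have [simp]: "x \<in> carrier M" "x divides d" "y \<in> carrier M" "y divides d"
      by (auto simp: interval_hoop_simps)
    show "x \<otimes>\<^bsub>?D\<^esub> y \<in> carrier ?D" by (simp add: interval_hoop_simps)
    show "x \<otimes>\<^bsub>?D\<^esub> y = y \<otimes>\<^bsub>?D\<^esub> x" by (simp add: interval_hoop_simps m_comm)
    show "x \<preceq>\<^bsub>?D\<^esub> y \<or> y \<preceq>\<^bsub>?D\<^esub> x" using divides_linear[of x y] by (auto simp: interval_le_iff)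
    \<comment> \<open>The last two expressions are the meet and the join of \<open>x\<close> and
      \<open>y\<close>. Their symmetry gives divisibility and the Wajsberg law.\<close>
    have *: "x \<leadsto>\<^bsub>?D\<^esub> y \<in> carrier ?D \<and> x \<otimes>\<^bsub>?D\<^esub> (x \<leadsto>\<^bsub>?D\<^esub> y) = (if x divides y then y else x) \<and>
      (x \<leadsto>\<^bsub>?D\<^esub> y) \<leadsto>\<^bsub>?D\<^esub> y = (if x divides y then x else y)"
      if [simp]: "x \<in> carrier M" "x divides d" "y \<in> carrier M" "y divides d" for x y
    proof (cases "x divides y")
      case True
      then obtain c where [simp]: "c \<in> carrier M" and c: "y = x \<otimes> c" by (auto elim: dividesE)
      have "c divides d" using dvd_l[of c x d] \<open>y divides d\<close> by (simp add: c m_comm)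
      then show ?thesis
        using True interval_imp_eq[of x c y] interval_imp_eq[of c x y] \<open>y divides d\<close>
        by (simp add: c m_comm interval_hoop_simps)
    next
      case False
      then have "y divides x" using divides_linear[of x y] by simp
      then show ?thesis
        using False interval_imp_one[of y x] interval_imp_eq[of \<one> y y]
        by (simp add: interval_hoop_simps)
    qed
    show "x \<leadsto>\<^bsub>?D\<^esub> y \<in> carrier ?D" using *[of x y] by simp
    show "x \<otimes>\<^bsub>?D\<^esub> (x \<leadsto>\<^bsub>?D\<^esub> y) = y \<otimes>\<^bsub>?D\<^esub> (y \<leadsto>\<^bsub>?D\<^esub> x)"
      "(x \<leadsto>\<^bsub>?D\<^esub> y) \<leadsto>\<^bsub>?D\<^esub> y = (y \<leadsto>\<^bsub>?D\<^esub> x) \<leadsto>\<^bsub>?D\<^esub> x"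
      using *[of x y] *[of y x] divides_linear[of x y] divides_antisym[of x y] by auto
  next
    fix x y z assume "x \<in> carrier ?D" "y \<in> carrier ?D" "z \<in> carrier ?D"
    then have [simp]: "x \<in> carrier M" "x divides d" "y \<in> carrier M" "y divides d"
        "z \<in> carrier M" "z divides d"
      by (auto simp: interval_hoop_simps)
    have T_closed: "T w \<in> carrier M" if "w \<in> carrier M" for w using that by (simp add: T_def)
    have mult: "u \<otimes>\<^bsub>?D\<^esub> w = T (u \<otimes> w)" for u w by (simp add: interval_hoop_simps T_def)
    have "T (T (x \<otimes> y) \<otimes> z) = T (x \<otimes> T (y \<otimes> z))"
      using T_mult[of z "x \<otimes> y"] T_mult[of x "y \<otimes> z"] T_closed by (simp add: m_ac)
    then show "x \<otimes>\<^bsub>?D\<^esub> y \<otimes>\<^bsub>?D\<^esub> z = x \<otimes>\<^bsub>?D\<^esub> (y \<otimes>\<^bsub>?D\<^esub> z)"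
      by (simp add: mult)
    show "x \<leadsto>\<^bsub>?D\<^esub> y \<leadsto>\<^bsub>?D\<^esub> z = (x \<otimes>\<^bsub>?D\<^esub> y) \<leadsto>\<^bsub>?D\<^esub> z"
    proof (cases "y divides z")
      case False
      then have zy: "z divides y" using divides_linear[of y z] by simp
      have "z divides (x \<otimes>\<^bsub>?D\<^esub> y)" using zy by (simp add: interval_hoop_simps divides_prod_l)
      then have "(x \<otimes>\<^bsub>?D\<^esub> y) \<leadsto>\<^bsub>?D\<^esub> z = \<one>" by (intro interval_imp_one) (auto simp: interval_hoop_simps)
      then show ?thesis using interval_imp_one[OF zy] interval_imp_one[of \<one> x] by simp
    next
      case True
      then obtain c where [simp]: "c \<in> carrier M" and z: "z = y \<otimes> c" by (auto elim: dividesE)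
      have yz: "y \<leadsto>\<^bsub>?D\<^esub> z = c" by (rule interval_imp_eq) (simp_all add: z)
      \<comment> \<open>If \<open>x\<close> divides \<open>c\<close>, then
        \<open>x \<otimes> y\<close> divides \<open>z\<close>, hence \<open>d\<close>, and is not
        truncated. Otherwise both sides are \<open>\<one>\<close>.\<close>
      show ?thesis
      proof (cases "x divides c")
        case True
        then obtain e where [simp]: "e \<in> carrier M" and c: "c = x \<otimes> e" by (auto elim: dividesE)
        have z': "z = x \<otimes> y \<otimes> e" by (simp add: z c m_ac)
        then have xy: "x \<otimes>\<^bsub>?D\<^esub> y = x \<otimes> y"
          using dvd_l[of "x \<otimes> y" e d] \<open>z divides d\<close> by (simp add: interval_hoop_simps)
        have "(x \<otimes> y) \<leadsto>\<^bsub>?D\<^esub> z = e" by (rule interval_imp_eq) (simp_all add: z')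
        moreover have "x \<leadsto>\<^bsub>?D\<^esub> c = e" by (rule interval_imp_eq) (simp_all add: c)
        ultimately show ?thesis by (simp add: yz xy)
      next
        case False
        then have cx: "c divides x" using divides_linear[of x c] by simp
        then have "z divides (x \<otimes> y)" using divides_mult_rI[of c x y] by (simp add: z m_comm)
        then have "z divides (x \<otimes>\<^bsub>?D\<^esub> y)" by (simp add: interval_hoop_simps)
        then have "(x \<otimes>\<^bsub>?D\<^esub> y) \<leadsto>\<^bsub>?D\<^esub> z = \<one>" by (intro interval_imp_one) (auto simp: interval_hoop_simps)
        then show ?thesis using interval_imp_one[OF cx] by (simp add: yz)
      qed
    qed
  qed
qed

section \<open>Powers in the cancellative monoid and in its intervals\<close>

lemma interval_pow:
  assumes [simp]: "y \<in> carrier M" "d \<in> carrier M" and "(y [^] n) divides d"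
  shows "y [^]\<^bsub>interval_hoop M d\<^esub> n = y [^] (n :: nat)"
  using assms(3)
proof (induction n)
  case (Suc n)
  have "(y [^] n) divides (y [^] Suc n)" by (rule dividesI[of y]) simp_all
  then have "(y [^] n) divides d" using divides_trans[OF _ Suc.prems] by simp
  then show ?case using Suc by (simp add: interval_hoop_simps)
qed (simp add: interval_hoop_simps)

lemma pow_divides_pow:
  assumes "a divides b" and [simp]: "a \<in> carrier M" "b \<in> carrier M"
  shows "(a [^] n) divides (b [^] (n :: nat))"
proof -
  obtain c where [simp]: "c \<in> carrier M" and b: "b = a \<otimes> c" using assms by (auto elim: dividesE)
  show ?thesis by (rule dividesI[of "c [^] n"]) (simp_all add: b nat_pow_distrib)
qed

lemma pow_eq_one:
  assumes "a [^] n = \<one>" "0 < (n :: nat)" and [simp]: "a \<in> carrier M"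
  shows "a = \<one>"
proof -
  obtain m where "n = Suc m" using assms(2) by (cases n) auto
  then show ?thesis using assms(1) conical[of a "a [^] m"] by (simp add: m_comm)
qed

text \<open>By linearity one may take \<open>b = a \<otimes> c\<close>. Cancelling
  \<open>a [^] k\<close> leaves \<open>c [^] k = \<one>\<close>, and a conical monoid has no
  torsion.\<close>

lemma inj_on_pow:
  assumes k: "0 < (k :: nat)"
  shows "inj_on (\<lambda>a. a [^] k) (carrier M)"
proof (rule inj_onI)
  have *: "a = b" if ab: "a divides b" "a [^] k = b [^] k" and [simp]: "a \<in> carrier M" "b \<in> carrier M" for a b
  proof -
    obtain c where [simp]: "c \<in> carrier M" and b: "b = a \<otimes> c" using ab(1) by (auto elim: dividesE)
    have "a [^] k \<otimes> \<one> = a [^] k \<otimes> c [^] k" using ab(2) by (simp add: b nat_pow_distrib)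
    then have "c [^] k = \<one>" by (metis l_cancel nat_pow_closed one_closed \<open>a \<in> carrier M\<close> \<open>c \<in> carrier M\<close>)
    then show "a = b" using pow_eq_one[of c k] k by (simp add: b)
  qed
  fix a b assume "a \<in> carrier M" "b \<in> carrier M" "a [^] k = b [^] k"
  then show "a = b" using *[of a b] *[of b a] divides_linear[of a b] by auto
qed

lemma hoop_hom_pow:
  assumes [simp]: "d \<in> carrier M"
  shows "hoop_hom (interval_hoop M d) (interval_hoop M (d [^] (k :: nat))) (\<lambda>a. a [^] k)"
  unfolding hoop_hom_def
proof (intro conjI ballI funcsetI)
  fix a assume "a \<in> carrier (interval_hoop M d)"
  then have a [simp]: "a \<in> carrier M" "a divides d" by (auto simp: interval_hoop_simps)
  then show "a [^] k \<in> carrier (interval_hoop M (d [^] k))"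
    by (simp add: interval_hoop_simps pow_divides_pow)
  fix b assume "b \<in> carrier (interval_hoop M d)"
  then have b [simp]: "b \<in> carrier M" "b divides d" by (auto simp: interval_hoop_simps)
  show "(a \<otimes>\<^bsub>interval_hoop M d\<^esub> b) [^] k = a [^] k \<otimes>\<^bsub>interval_hoop M (d [^] k)\<^esub> b [^] k"
  proof (cases "(a \<otimes> b) divides d")
    case True
    then show ?thesis using pow_divides_pow[OF True, of k]
      by (simp add: interval_hoop_simps nat_pow_distrib)
  next
    case False
    then have "d divides (a \<otimes> b)" using divides_linear[of d "a \<otimes> b"] by simp
    \<comment> \<open>When \<open>a \<otimes> b\<close> is truncated to \<open>d\<close>, the
      product of the powers is at or beyond \<open>d [^] k\<close>, so both sides equal
      \<open>d [^] k\<close>.\<close>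
    then have "(d [^] k) divides (a [^] k \<otimes> b [^] k)"
      using pow_divides_pow[of d "a \<otimes> b" k] by (simp add: nat_pow_distrib)
    then show ?thesis using False divides_antisym[of "d [^] k" "a [^] k \<otimes> b [^] k"]
      by (auto simp: interval_hoop_simps)
  qed
  show "(a \<leadsto>\<^bsub>interval_hoop M d\<^esub> b) [^] k = a [^] k \<leadsto>\<^bsub>interval_hoop M (d [^] k)\<^esub> b [^] k"
  proof (cases "a divides b")
    case True
    then obtain c where [simp]: "c \<in> carrier M" and c: "b = a \<otimes> c" by (auto elim: dividesE)
    have "a [^] k \<leadsto>\<^bsub>interval_hoop M (d [^] k)\<^esub> b [^] k = c [^] k"
      by (rule interval_imp_eq) (simp_all add: c nat_pow_distrib)
    moreover have "a \<leadsto>\<^bsub>interval_hoop M d\<^esub> b = c" by (rule interval_imp_eq) (simp_all add: c)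
    ultimately show ?thesis by simp
  next
    case False
    then have "b divides a" using divides_linear[of a b] by simp
    then show ?thesis using interval_imp_one pow_divides_pow by simp
  qed
qed (simp add: interval_hoop_simps)

end

section \<open>The cancellative cover of a bounded chain\<close>

text \<open>Above \<open>p\<close>, implication into \<open>p\<close> is an involution, so the
  Lukasiewicz sum relative to \<open>p\<close> commutes. It is used below with the bottom
  \<open>z\<close>, with \<open>c \<leadsto> z\<close> and with \<open>c\<close> in the role of
  \<open>p\<close>.\<close>

lemma (in wajsberg_hoop) imp_imp_left_commute:
  assumes "p \<preceq> a" "p \<preceq> b" and [simp]: "p \<in> carrier A" "a \<in> carrier A" "b \<in> carrier A"
  shows "(b \<leadsto> p) \<leadsto> a = (a \<leadsto> p) \<leadsto> b"
proof -
  have "(b \<leadsto> p) \<leadsto> ((a \<leadsto> p) \<leadsto> p) = (a \<leadsto> p) \<leadsto> ((b \<leadsto> p) \<leadsto> p)" by (rule imp_swap) simp_all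
  then show ?thesis using assms by (simp add: imp_imp_of_le)
qed

locale bounded_wajsberg_chain = wajsberg_chain +
  fixes z
  assumes bot_closed [simp]: "z \<in> carrier A"
    and bot_le [simp]: "a \<in> carrier A \<Longrightarrow> z \<preceq> a"
    and bot_neq_one: "z \<noteq> \<one>"
begin

text \<open>
  The pair \<open>(m, a)\<close> stands for the product of \<open>a\<close> with the \<open>m\<close>-th power of \<open>z\<close>, taken in a
  cancellative chain in which \<open>A\<close> is the interval from \<open>z\<close> to \<open>\<one>\<close>. The restriction \<open>a \<noteq> z\<close>
  makes the representation unique; a product that reaches \<open>z\<close> produces a carry.
\<close>

definition cover :: "(nat \<times> 'a) monoid"
  where "cover = \<lparr>carrier = UNIV \<times> (carrier A - {z}),
    monoid.mult = (\<lambda>(m, a) (n, b).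
      if a \<otimes> b = z then (Suc (m + n), (a \<leadsto> z) \<leadsto> b) else (m + n, a \<otimes> b)),
    one = (0, \<one>)\<rparr>"

lemma cover_simps:
  "carrier cover = UNIV \<times> (carrier A - {z})"
  "\<one>\<^bsub>cover\<^esub> = (0, \<one>)"
  "(m, a) \<otimes>\<^bsub>cover\<^esub> (n, b) =
    (if a \<otimes> b = z then (Suc (m + n), (a \<leadsto> z) \<leadsto> b) else (m + n, a \<otimes> b))"
  by (simp_all add: cover_def)

lemma neg_neg [simp]: "a \<in> carrier A \<Longrightarrow> (a \<leadsto> z) \<leadsto> z = a"
  by (simp add: imp_imp_of_le)

lemma bot_imp [simp]: "a \<in> carrier A \<Longrightarrow> z \<leadsto> a = \<one>"
  using bot_le by (simp add: hoop_le_def)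

lemma le_bot_iff: "a \<in> carrier A \<Longrightarrow> a \<preceq> z \<longleftrightarrow> a = z"
  using le_antisym[of a z] by auto

lemma mult_bot [simp]: "a \<in> carrier A \<Longrightarrow> a \<otimes> z = z" "a \<in> carrier A \<Longrightarrow> z \<otimes> a = z"
  using mult_le_left[of a z] by (simp_all add: le_bot_iff m_comm)

lemma mult_eq_bot_iff:
  "\<lbrakk>a \<in> carrier A; b \<in> carrier A\<rbrakk> \<Longrightarrow> a \<otimes> b = z \<longleftrightarrow> b \<preceq> a \<leadsto> z"
  using residuation[of b a z] by (simp add: le_bot_iff m_comm)

text \<open>The expression \<open>(a \<leadsto> z) \<leadsto> b\<close> is the Lukasiewicz sum of
  \<open>a\<close> and \<open>b\<close>; it is the remainder left by a product that carries.\<close>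

lemma sum_comm:
  "\<lbrakk>a \<in> carrier A; b \<in> carrier A\<rbrakk> \<Longrightarrow> (a \<leadsto> z) \<leadsto> b = (b \<leadsto> z) \<leadsto> a"
  by (rule imp_imp_left_commute) simp_all

text \<open>After a carry, \<open>b\<close> can be recovered from \<open>a\<close> and the
  remainder. This keeps remainders away from \<open>z\<close> and yields cancellation in the
  cover.\<close>

lemma mult_sum:
  assumes "a \<otimes> b = z" and [simp]: "a \<in> carrier A" "b \<in> carrier A"
  shows "(a \<leadsto> z) \<otimes> ((a \<leadsto> z) \<leadsto> b) = b"
  using assms by (intro mult_imp_of_le) (simp_all add: mult_eq_bot_iff)

lemma sum_neq_bot:
  assumes "a \<otimes> b = z" "a \<in> carrier A" "b \<in> carrier A" "b \<noteq> z"
  shows "(a \<leadsto> z) \<leadsto> b \<noteq> z"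
proof
  assume "(a \<leadsto> z) \<leadsto> b = z"
  then show False using mult_sum[OF assms(1-3)] assms by simp
qed

text \<open>This lemma and the next two treat the carry patterns of \<open>a \<otimes> c\<close> and
  \<open>b \<otimes> c\<close>: neither, exactly one, or both. Here linearity puts
  \<open>c \<leadsto> z\<close> below \<open>a\<close> and \<open>b\<close>, and the sum relative to
  \<open>c \<leadsto> z\<close> commutes.\<close>

lemma sum_mult_left_commute:
  assumes "a \<otimes> c \<noteq> z" "b \<otimes> c \<noteq> z"
    and [simp]: "a \<in> carrier A" "b \<in> carrier A" "c \<in> carrier A"
  shows "(a \<leadsto> z) \<leadsto> b \<otimes> c = (b \<leadsto> z) \<leadsto> a \<otimes> c"
proof -
  have "\<not> a \<preceq> c \<leadsto> z" "\<not> b \<preceq> c \<leadsto> z"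
    using assms(1,2) m_comm[of a c] m_comm[of b c]
    by (simp_all add: mult_eq_bot_iff[symmetric])
  then have "c \<leadsto> z \<preceq> a" "c \<leadsto> z \<preceq> b"
    using linear[of a "c \<leadsto> z"] linear[of b "c \<leadsto> z"] by simp_all
  then have "(b \<leadsto> (c \<leadsto> z)) \<leadsto> a = (a \<leadsto> (c \<leadsto> z)) \<leadsto> b"
    by (rule imp_imp_left_commute) simp_all
  then show ?thesis
    using sum_comm[of a "b \<otimes> c"] sum_comm[of b "a \<otimes> c"] by (simp add: imp_imp)
qed

text \<open>The carry happens in the inner product on one side and in the outer product on the
  other. Multiplying both remainders by \<open>a \<leadsto> z\<close> gives
  \<open>b \<otimes> c\<close>, which is not \<open>z\<close>, so this factor cancels.\<close>

lemma mult_sum_eq_sum_mult: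
  assumes ac: "a \<otimes> c = z" and bc: "b \<otimes> c \<noteq> z"
    and [simp]: "a \<in> carrier A" "b \<in> carrier A" "c \<in> carrier A"
  shows "b \<otimes> ((a \<leadsto> z) \<leadsto> c) = (a \<leadsto> z) \<leadsto> b \<otimes> c" "b \<otimes> ((a \<leadsto> z) \<leadsto> c) \<noteq> z"
proof -
  define q d where "q = a \<leadsto> z" and "d = q \<leadsto> c"
  have [simp]: "q \<in> carrier A" "d \<in> carrier A" by (simp_all add: q_def d_def)
  have "q \<otimes> d = c" using mult_sum[OF ac] by (simp add: q_def d_def)
  then have *: "q \<otimes> (b \<otimes> d) = b \<otimes> c" using m_lcomm[of q b d] by simp
  then have "\<not> q \<otimes> (b \<otimes> d) \<preceq> z" using bc by (simp add: le_bot_iff)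
  then have "q \<leadsto> q \<otimes> (b \<otimes> d) = b \<otimes> d" by (rule imp_mult_cancel[rotated 3]) simp_all
  then show "b \<otimes> ((a \<leadsto> z) \<leadsto> c) = (a \<leadsto> z) \<leadsto> b \<otimes> c"
    by (simp add: * q_def[symmetric] d_def[symmetric])
  show "b \<otimes> ((a \<leadsto> z) \<leadsto> c) \<noteq> z"
  proof
    assume "b \<otimes> ((a \<leadsto> z) \<leadsto> c) = z"
    then show False using * bc by (simp add: q_def[symmetric] d_def[symmetric])
  qed
qed

text \<open>Implication into \<open>z\<close> is injective, and it turns the claim into
  commutativity of a sum relative to \<open>c\<close>.\<close>

lemma mult_sum_left_commute:
  assumes ac: "a \<otimes> c = z" and bc: "b \<otimes> c = z"
    and [simp]: "a \<in> carrier A" "b \<in> carrier A" "c \<in> carrier A"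
  shows "a \<otimes> ((b \<leadsto> z) \<leadsto> c) = b \<otimes> ((a \<leadsto> z) \<leadsto> c)"
proof -
  have neg: "b \<otimes> ((a \<leadsto> z) \<leadsto> c) \<leadsto> z = ((a \<leadsto> z) \<leadsto> c) \<leadsto> (b \<leadsto> z)"
    if [simp]: "a \<in> carrier A" "b \<in> carrier A" for a b
    by (simp add: imp_imp m_comm)
  have "((b \<leadsto> z) \<leadsto> c) \<leadsto> (a \<leadsto> z) = ((a \<leadsto> z) \<leadsto> c) \<leadsto> (b \<leadsto> z)"
    using ac bc by (intro imp_imp_left_commute) (simp_all add: mult_eq_bot_iff)
  then have "a \<otimes> ((b \<leadsto> z) \<leadsto> c) \<leadsto> z = b \<otimes> ((a \<leadsto> z) \<leadsto> c) \<leadsto> z" by (simp add: neg)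
  then have "(a \<otimes> ((b \<leadsto> z) \<leadsto> c) \<leadsto> z) \<leadsto> z = (b \<otimes> ((a \<leadsto> z) \<leadsto> c) \<leadsto> z) \<leadsto> z" by simp
  then show ?thesis by simp
qed

text \<open>With commutativity this is associativity, but in a form symmetric in \<open>u\<close>
  and \<open>v\<close>, which leaves fewer carry patterns to treat.\<close>

lemma cover_left_commute:
  assumes "u \<in> carrier cover" "v \<in> carrier cover" "w \<in> carrier cover"
  shows "u \<otimes>\<^bsub>cover\<^esub> (v \<otimes>\<^bsub>cover\<^esub> w) = v \<otimes>\<^bsub>cover\<^esub> (u \<otimes>\<^bsub>cover\<^esub> w)"
proof -
  obtain m a n b l c where uvw: "u = (m, a)" "v = (n, b)" "w = (l, c)"
    by (cases u, cases v, cases w)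
  have [simp]: "a \<in> carrier A" "b \<in> carrier A" "c \<in> carrier A"
    using assms by (auto simp: cover_simps uvw)
  have swap: "a \<otimes> (b \<otimes> c) = b \<otimes> (a \<otimes> c)" by (rule m_lcomm) simp_all
  consider "a \<otimes> c \<noteq> z" "b \<otimes> c \<noteq> z" | "a \<otimes> c = z" "b \<otimes> c \<noteq> z"
    | "a \<otimes> c \<noteq> z" "b \<otimes> c = z" | "a \<otimes> c = z" "b \<otimes> c = z" by blast
  then show ?thesis
  proof cases
    case 1
    then show ?thesis using swap sum_mult_left_commute[of a c b] by (simp add: cover_simps uvw)
  next
    case 2
    moreover have "a \<otimes> (b \<otimes> c) = z" using swap 2 by simp
    ultimately show ?thesis using mult_sum_eq_sum_mult[of a c b] by (simp add: cover_simps uvw)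
  next
    case 3
    moreover have "b \<otimes> (a \<otimes> c) = z" using swap[symmetric] 3 by simp
    ultimately show ?thesis using mult_sum_eq_sum_mult[of b c a] by (simp add: cover_simps uvw)
  next
    case 4
    then show ?thesis
      using mult_sum_left_commute[of a c b] imp_swap[of "a \<leadsto> z" "b \<leadsto> z" c]
      by (simp add: cover_simps uvw)
  qed
qed

lemma comm_monoid_cover: "comm_monoid cover"
proof (rule comm_monoidI)
  show closed: "u \<otimes>\<^bsub>cover\<^esub> v \<in> carrier cover" if "u \<in> carrier cover" "v \<in> carrier cover" for u v
    using that sum_neq_bot by (cases u; cases v) (auto simp: cover_simps)
  show comm: "u \<otimes>\<^bsub>cover\<^esub> v = v \<otimes>\<^bsub>cover\<^esub> u" if "u \<in> carrier cover" "v \<in> carrier cover" for u v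
    using that sum_comm[of "snd u" "snd v"] m_comm[of "snd u" "snd v"]
    by (cases u; cases v) (auto simp: cover_simps)
  show "u \<otimes>\<^bsub>cover\<^esub> v \<otimes>\<^bsub>cover\<^esub> w = u \<otimes>\<^bsub>cover\<^esub> (v \<otimes>\<^bsub>cover\<^esub> w)"
    if "u \<in> carrier cover" "v \<in> carrier cover" "w \<in> carrier cover" for u v w
    using that cover_left_commute[of w u v] comm[of "u \<otimes>\<^bsub>cover\<^esub> v" w] comm[of w v] closed by simp
qed (use bot_neq_one in \<open>auto simp: cover_simps split: if_splits\<close>)

text \<open>Divisibility in the cover follows the lexicographic order, with the second component
  reversed.\<close>

lemma cover_divides:
  assumes "a \<in> carrier A" "a \<noteq> z" "b \<in> carrier A" "b \<noteq> z" "m < n \<or> m = n \<and> b \<preceq> a"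
  shows "(m, a) divides\<^bsub>cover\<^esub> (n, b)"
proof (cases "b \<preceq> a")
  case True
  then have ab: "a \<otimes> (a \<leadsto> b) = b" using assms by (simp add: mult_imp_of_le)
  have "a \<leadsto> b \<noteq> z"
  proof
    assume "a \<leadsto> b = z"
    then show False using ab assms by simp
  qed
  then show ?thesis
    using assms ab by (intro dividesI[of "(n - m, a \<leadsto> b)"]) (auto simp: cover_simps)
next
  case False
  have [simp]: "a \<in> carrier A" "b \<in> carrier A" using assms by simp_all
  \<comment> \<open>A borrow is needed: \<open>c\<close> is chosen so that
    \<open>a \<otimes> c\<close> carries and leaves the remainder \<open>b\<close>.\<close>
  define c where "c = (a \<leadsto> z) \<otimes> b"
  have "c \<noteq> z" using False mult_eq_bot_iff[of "a \<leadsto> z" b] by (simp add: c_def)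
  have "a \<otimes> c = z" using mult_eq_bot_iff[of a c] mult_le_right by (simp add: c_def)
  moreover have "(a \<leadsto> z) \<leadsto> c = b"
    unfolding c_def using \<open>c \<noteq> z\<close> by (intro imp_mult_cancel[of _ _ z]) (simp_all add: c_def le_bot_iff)
  ultimately show ?thesis
    using False assms(5) \<open>c \<noteq> z\<close>
    by (intro dividesI[of "(n - Suc m, c)"]) (auto simp: cover_simps c_def)
qed

sublocale cover: divisibility_chain cover
proof -
  interpret M: comm_monoid cover by (rule comm_monoid_cover)
  \<comment> \<open>The counters alone do not prevent a product with carry from equalling one
    without. If the second components agreed, \<open>a\<close> would absorb \<open>b\<close>, the
    remainder would be \<open>a\<close>, and \<open>b'\<close> would be \<open>z\<close>.\<close>
  have no_mixed: "\<not> (a \<otimes> b = (a \<leadsto> z) \<leadsto> b')"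
    if "a \<otimes> b \<noteq> z" "a \<otimes> b' = z" "a \<in> carrier A" "b \<in> carrier A" "b' \<in> carrier A" "b' \<noteq> z" for a b b'
  proof
    assume eq: "a \<otimes> b = (a \<leadsto> z) \<leadsto> b'"
    have "(a \<leadsto> z) \<leadsto> z \<preceq> (a \<leadsto> z) \<leadsto> b'"
      using imp_mono_right[of z b' "a \<leadsto> z"] that by (simp add: hoop_le_def)
    then have "a \<otimes> b = a" using eq that mult_le_right[of a b] by (intro le_antisym) auto
    then have "b' = (a \<leadsto> z) \<otimes> a" using mult_sum[of a b'] eq that by simp
    then show False using mult_imp_le[of a z] that by (simp add: le_bot_iff)
  qed
  have cancel: "u = v" if uv: "w \<otimes>\<^bsub>cover\<^esub> u = w \<otimes>\<^bsub>cover\<^esub> v"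
    and c: "u \<in> carrier cover" "v \<in> carrier cover" "w \<in> carrier cover" for u v w
  proof -
    obtain m a n b l d where e: "w = (m, a)" "u = (n, b)" "v = (l, d)"
      by (cases w, cases u, cases v)
    have [simp]: "a \<in> carrier A" "b \<in> carrier A" "d \<in> carrier A" "b \<noteq> z" "d \<noteq> z"
      using c by (auto simp: cover_simps e)
    show ?thesis
    proof (cases "a \<otimes> b = z"; cases "a \<otimes> d = z")
      assume bot: "a \<otimes> b = z" "a \<otimes> d = z"
      then have "(a \<leadsto> z) \<otimes> ((a \<leadsto> z) \<leadsto> b) = b" "(a \<leadsto> z) \<otimes> ((a \<leadsto> z) \<leadsto> d) = d"
        by (simp_all add: mult_sum)
      moreover have "n = l" "(a \<leadsto> z) \<leadsto> b = (a \<leadsto> z) \<leadsto> d"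
        using uv bot by (simp_all add: cover_simps e)
      ultimately show ?thesis unfolding e by metis
    next
      assume nz: "a \<otimes> b \<noteq> z" "a \<otimes> d \<noteq> z"
      have "a \<leadsto> a \<otimes> b = b" "a \<leadsto> a \<otimes> d = d"
        by (rule imp_mult_cancel[of _ _ z]; simp add: le_bot_iff nz)+
      moreover have "n = l" "a \<otimes> b = a \<otimes> d" using uv nz by (simp_all add: cover_simps e)
      ultimately show ?thesis unfolding e by metis
    qed (use uv no_mixed[of a b d] no_mixed[of a d b] in \<open>auto simp: cover_simps e\<close>)
  qed
  have "comm_monoid_cancel cover"
    by (rule comm_monoid_cancelI[OF comm_monoid_cover]) (metis cancel M.m_comm)
  then interpret M: comm_monoid_cancel cover .
  show "divisibility_chain cover"
  proof unfold_locales
    fix u v assume "u \<in> carrier cover" "v \<in> carrier cover"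
    moreover obtain m a n b where e: "u = (m, a)" "v = (n, b)" by (cases u, cases v)
    ultimately have ab: "a \<in> carrier A" "b \<in> carrier A" "a \<noteq> z" "b \<noteq> z"
      by (auto simp: cover_simps)
    show "u divides\<^bsub>cover\<^esub> v \<or> v divides\<^bsub>cover\<^esub> u"
      unfolding e using ab linear[of a b] cover_divides[of a b m n] cover_divides[of b a n m]
      by (metis linorder_neqE_nat)
    assume "u \<otimes>\<^bsub>cover\<^esub> v = \<one>\<^bsub>cover\<^esub>"
    then show "u = \<one>\<^bsub>cover\<^esub>"
      using ab mult_le_right[of a b] by (auto simp: cover_simps e one_le_iff split: if_splits)
  qed
qed

text \<open>The pair \<open>(0, z)\<close> is not in the carrier; the first power of
  \<open>z\<close> is written \<open>(1, \<one>)\<close>.\<close>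

definition cover_embed :: "'a \<Rightarrow> nat \<times> 'a"
  where "cover_embed a = (if a = z then (1, \<one>) else (0, a))"

lemma cover_embed_closed [simp]: "a \<in> carrier A \<Longrightarrow> cover_embed a \<in> carrier cover"
  using bot_neq_one by (auto simp: cover_embed_def cover_simps)

lemma inj_cover_embed: "inj cover_embed"
  by (auto simp: cover_embed_def inj_def)

lemma cover_embed_divides: "a \<in> carrier A \<Longrightarrow> cover_embed a divides\<^bsub>cover\<^esub> (cover_embed z)"
  using bot_neq_one cover_divides[of a \<one> 0 1]
  by (cases "a = z") (simp_all add: cover_embed_def cover_simps)

lemma hoop_hom_cover_embed: "hoop_hom A (interval_hoop cover (cover_embed z)) cover_embed"
proof -
  let ?D = "interval_hoop cover (cover_embed z)"
  have trunc: "(if u divides\<^bsub>cover\<^esub> (cover_embed z) then u else cover_embed z) = cover_embed z"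
    if "(cover_embed z) divides\<^bsub>cover\<^esub> u" "u \<in> carrier cover" for u
    using cover.divides_antisym[of u "cover_embed z"] that by auto
  \<comment> \<open>A product of embedded elements that carries lies at or beyond the image of
    \<open>z\<close>, so it is truncated there.\<close>
  have carry: "(cover_embed z) divides\<^bsub>cover\<^esub> (Suc 0, c)" if "c \<in> carrier A" "c \<noteq> z" for c
    using that bot_neq_one cover_divides[of \<one> c 1 1] by (simp add: cover_embed_def)
  have mult: "cover_embed (a \<otimes> b) = cover_embed a \<otimes>\<^bsub>?D\<^esub> cover_embed b"
    if [simp]: "a \<in> carrier A" "b \<in> carrier A" for a b
  proof (cases "a = z \<or> b = z")
    case True
    then have "(cover_embed z) divides\<^bsub>cover\<^esub> (cover_embed a \<otimes>\<^bsub>cover\<^esub> cover_embed b)"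
      by (auto intro: cover.divides_prod_r cover.divides_prod_l)
    then show ?thesis using True trunc by (auto simp: interval_hoop_simps)
  next
    case False
    show ?thesis
    proof (cases "a \<otimes> b = z")
      case True
      have eq: "cover_embed a \<otimes>\<^bsub>cover\<^esub> cover_embed b = (Suc 0, (a \<leadsto> z) \<leadsto> b)"
        using False True by (simp add: cover_embed_def cover_simps)
      have "(cover_embed z) divides\<^bsub>cover\<^esub> (cover_embed a \<otimes>\<^bsub>cover\<^esub> cover_embed b)"
        unfolding eq using False True sum_neq_bot by (intro carry) auto
      then show ?thesis using True trunc by (simp add: interval_hoop_simps)
    next
      case ab: False
      have "cover_embed a \<otimes>\<^bsub>cover\<^esub> cover_embed b = cover_embed (a \<otimes> b)"
        using ab False by (simp add: cover_embed_def cover_simps)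
      then show ?thesis using cover_embed_divides[of "a \<otimes> b"] by (simp add: interval_hoop_simps)
    qed
  qed
  have imp: "cover_embed (a \<leadsto> b) = cover_embed a \<leadsto>\<^bsub>?D\<^esub> cover_embed b"
    if [simp]: "a \<in> carrier A" "b \<in> carrier A" for a b
  proof (cases "a \<preceq> b")
    case True
    have "(cover_embed b) divides\<^bsub>cover\<^esub> (cover_embed a)"
      using True cover_divides[of b a 0 0] cover_embed_divides[of b] le_bot_iff[of a]
      by (auto simp: cover_embed_def)
    then have "cover_embed a \<leadsto>\<^bsub>?D\<^esub> cover_embed b = \<one>\<^bsub>cover\<^esub>"
      by (rule cover.interval_imp_one) simp_all
    then show ?thesis using True bot_neq_one by (simp add: hoop_le_def cover_embed_def cover_simps)
  next
    case False
    then have a: "a \<noteq> z" and ba: "b \<preceq> a" using linear[of a b] by auto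
    have ab: "a \<otimes> (a \<leadsto> b) = b" using ba by (simp add: mult_imp_of_le)
    \<comment> \<open>The implication is a quotient, unique by cancellation, so multiplying back
      suffices. If \<open>b = z\<close>, the product carries with remainder
      \<open>(a \<leadsto> z) \<leadsto> (a \<leadsto> z) = \<one>\<close>, except when
      \<open>a = \<one>\<close>, where \<open>a \<leadsto> b\<close> is \<open>z\<close>
      itself.\<close>
    have "cover_embed a \<otimes>\<^bsub>cover\<^esub> cover_embed (a \<leadsto> b) = cover_embed b"
    proof (cases "b = z")
      case True
      have "a = \<one>" if "a \<leadsto> z = z" using neg_neg[of a] that by (simp del: neg_neg)
      then show ?thesis using True a ab bot_neq_one
        by (auto simp: cover_embed_def cover_simps imp_refl)
    next
      case False
      have "a \<leadsto> b \<noteq> z"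
      proof
        assume "a \<leadsto> b = z"
        then show False using ab \<open>b \<noteq> z\<close> by simp
      qed
      then show ?thesis using a ab False by (simp add: cover_embed_def cover_simps)
    qed
    then show ?thesis by (intro cover.interval_imp_eq[symmetric]) simp_all
  qed
  show ?thesis
    unfolding hoop_hom_def using mult imp bot_neq_one cover_embed_divides
    by (auto simp: interval_hoop_simps) (simp add: cover_embed_def cover_simps)
qed

end

section \<open>Conucleus terms\<close>

text \<open>Submultiplicativity is iterated from exponent 1. Exponent 0 would require
  \<open>\<delta> \<one> = \<one>\<close>, which a conucleus need not satisfy.\<close>

lemma (in conucleus) pow_le:
  assumes a [simp]: "a \<in> carrier A"
  shows "\<delta> a [^] Suc n \<preceq> \<delta> (a [^] Suc n)"
proof (induction n)
  case (Suc n)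
  have [simp]: "\<delta> b \<in> carrier A" if "b \<in> carrier A" for b using closed that .
  have "\<delta> a [^] Suc n \<otimes> \<delta> a \<preceq> \<delta> (a [^] Suc n) \<otimes> \<delta> a"
    by (rule mult_mono_left[OF Suc]) (simp_all del: nat_pow_Suc)
  moreover have "\<delta> (a [^] Suc n) \<otimes> \<delta> a \<preceq> \<delta> (a [^] Suc n \<otimes> a)"
    by (rule submultiplicative) simp_all
  ultimately have "\<delta> a [^] Suc n \<otimes> \<delta> a \<preceq> \<delta> (a [^] Suc n \<otimes> a)"
    by (rule le_trans) (simp_all del: nat_pow_Suc)
  then show ?case by (simp only: nat_pow_Suc[of _ "Suc n"])
qed (simp add: closed)

text \<open>
  In the interval from \<open>v [^] k\<close> to \<open>\<one>\<close> of the cover, where \<open>v\<close> is the image of \<open>z\<close>, the element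
  \<open>cover_embed x\<close> is so close to \<open>\<one>\<close> that \<open>t\<close> fixes it; hence \<open>t\<close> fixes its \<open>k\<close>-th power,
  the image of \<open>x\<close> under an embedding of \<open>A\<close>.
\<close>

lemma (in bounded_wajsberg_chain) term_op_eq_self:
  assumes deg: "term_degree t = 1"
    and con: "\<And>d. d \<in> carrier cover \<Longrightarrow>
      conucleus (interval_hoop cover d) (term_op (interval_hoop cover d) t)"
    and x [simp]: "x \<in> carrier A"
  shows "term_op A t x = x"
proof -
  define v where "v = cover_embed z"
  \<comment> \<open>One more than \<open>var_count t\<close>: that power of \<open>y\<close> is at
    or above the same power of \<open>v\<close>, which is strictly above the bottom
    \<open>v [^] k\<close>. So \<open>term_op_eq_pow\<close> will apply to \<open>y\<close>.\<close>
  define k where "k = Suc (var_count t)"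
  define y where "y = cover_embed x"
  have [simp]: "v \<in> carrier cover" "y \<in> carrier cover" by (simp_all add: v_def y_def)
  let ?d = "v [^]\<^bsub>cover\<^esub> k"
  let ?D = "interval_hoop cover ?d"
  interpret D: wajsberg_chain ?D by (rule cover.wajsberg_chain_interval) simp
  interpret T: conucleus ?D "term_op ?D t" by (rule con) simp
  have yv: "y divides\<^bsub>cover\<^esub> v" by (simp add: y_def v_def cover_embed_divides)
  have yk: "(y [^]\<^bsub>cover\<^esub> k) divides\<^bsub>cover\<^esub> ?d" by (rule cover.pow_divides_pow[OF yv]) simp_all
  have v_pow: "(v [^]\<^bsub>cover\<^esub> var_count t) divides\<^bsub>cover\<^esub> ?d"
    by (rule dividesI[of v]) (simp_all add: k_def)
  have yv_pow: "(y [^]\<^bsub>cover\<^esub> var_count t) divides\<^bsub>cover\<^esub> (v [^]\<^bsub>cover\<^esub> var_count t)"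
    by (rule cover.pow_divides_pow[OF yv]) simp_all
  then have yc: "(y [^]\<^bsub>cover\<^esub> var_count t) divides\<^bsub>cover\<^esub> ?d"
    by (rule cover.divides_trans[OF _ v_pow]) simp
  have "v divides\<^bsub>cover\<^esub> ?d"
    by (rule dividesI[of "v [^]\<^bsub>cover\<^esub> var_count t"]) (simp_all add: k_def cover.m_comm)
  then have "y divides\<^bsub>cover\<^esub> ?d" by (rule cover.divides_trans[OF yv]) simp
  then have y_D: "y \<in> carrier ?D" "?d \<in> carrier ?D" by (simp_all add: interval_hoop_simps)
  have "\<not> ?d divides\<^bsub>cover\<^esub> (y [^]\<^bsub>cover\<^esub> var_count t)"
  proof
    assume "?d divides\<^bsub>cover\<^esub> (y [^]\<^bsub>cover\<^esub> var_count t)"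
    then have "?d divides\<^bsub>cover\<^esub> (v [^]\<^bsub>cover\<^esub> var_count t)"
      by (rule cover.divides_trans[OF _ yv_pow]) simp
    then have "v [^]\<^bsub>cover\<^esub> var_count t \<otimes>\<^bsub>cover\<^esub> v = v [^]\<^bsub>cover\<^esub> var_count t \<otimes>\<^bsub>cover\<^esub> \<one>\<^bsub>cover\<^esub>"
      using cover.divides_antisym[OF v_pow] by (simp add: k_def)
    then have "v = \<one>\<^bsub>cover\<^esub>" by (rule cover.l_cancel) simp_all
    then show False by (simp add: v_def cover_embed_def cover_simps)
  qed
  then have "term_op ?D t y = y [^]\<^bsub>?D\<^esub> term_degree t"
    using y_D yc by (intro D.term_op_eq_pow[of _ ?d]) (auto simp: cover.interval_pow cover.interval_le_iff)
  then have ty: "term_op ?D t y = y" using y_D by (simp add: deg)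
  have "y [^]\<^bsub>?D\<^esub> k = y [^]\<^bsub>cover\<^esub> k" using yk by (simp add: cover.interval_pow)
  \<comment> \<open>Since \<open>t\<close> fixes \<open>y\<close>, \<open>pow_le\<close> bounds its
    value at the power from below; contraction gives the converse bound.\<close>
  then have ge: "y [^]\<^bsub>cover\<^esub> k \<preceq>\<^bsub>?D\<^esub> term_op ?D t (y [^]\<^bsub>cover\<^esub> k)"
    using T.pow_le[OF y_D(1), of "var_count t"] unfolding ty k_def[symmetric] by simp
  have yk_D: "y [^]\<^bsub>cover\<^esub> k \<in> carrier ?D" using yk by (simp add: interval_hoop_simps)
  have fixed: "term_op ?D t (y [^]\<^bsub>cover\<^esub> k) = y [^]\<^bsub>cover\<^esub> k"
    using D.le_antisym[OF T.contracting[OF yk_D] ge] yk_D by simp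
  \<comment> \<open>This composite of two embeddings commutes with \<open>t\<close>, so the fixed
    point \<open>h x\<close> pulls back to \<open>x\<close>.\<close>
  define h where "h a = cover_embed a [^]\<^bsub>cover\<^esub> k" for a
  have "h (term_op A t x) = term_op ?D t (h x)"
  proof -
    interpret V: wajsberg_chain "interval_hoop cover v" by (rule cover.wajsberg_chain_interval) simp
    have "term_op (interval_hoop cover v) t y = cover_embed (term_op A t x)"
      using term_op_hom[OF hoop_axioms hoop_hom_cover_embed x] by (simp add: y_def v_def)
    moreover have "term_op ?D t (y [^]\<^bsub>cover\<^esub> k) = term_op (interval_hoop cover v) t y [^]\<^bsub>cover\<^esub> k"
      using yv by (intro term_op_hom[OF V.hoop_axioms cover.hoop_hom_pow]) (simp_all add: interval_hoop_simps)
    ultimately show ?thesis by (simp add: h_def y_def)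
  qed
  then have "cover_embed (term_op A t x) [^]\<^bsub>cover\<^esub> k = cover_embed x [^]\<^bsub>cover\<^esub> k"
    using fixed by (simp add: h_def y_def)
  moreover have "inj_on (\<lambda>a. a [^]\<^bsub>cover\<^esub> k) (carrier cover)"
    by (rule cover.inj_on_pow) (simp add: k_def)
  ultimately have "cover_embed (term_op A t x) = cover_embed x"
    using inj_on_eq_iff[of "\<lambda>a. a [^]\<^bsub>cover\<^esub> k" "carrier cover" "cover_embed (term_op A t x)" "cover_embed x"]
    by simp
  then show ?thesis using inj_cover_embed by (simp add: inj_eq)
qed

section \<open>Unbounded chains, and the passage to all Wajsberg hoops\<close>

lemma (in wajsberg_chain) term_op_eq_self_of_unbounded:
  assumes "term_degree t = 1" and x [simp]: "x \<in> carrier A"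
    and "\<And>b. b \<in> carrier A \<Longrightarrow> \<exists>c\<in>carrier A. \<not> b \<preceq> c"
  shows "term_op A t x = x"
proof -
  obtain c where "c \<in> carrier A" "\<not> x [^] var_count t \<preceq> c"
    using assms(3)[of "x [^] var_count t"] by auto
  then show ?thesis using term_op_eq_pow[OF x] assms(1) by simp
qed

text \<open>The cover lives on pairs; an infinite universe absorbs the factor \<open>nat\<close>, so
  intervals of the cover can be copied back into it.\<close>

lemma exists_inj_nat_times:
  includes cardinal_syntax
  assumes "infinite (UNIV :: 'a set)"
  shows "\<exists>f :: nat \<times> 'a \<Rightarrow> 'a. inj f"
proof -
  have "|UNIV :: nat set| \<le>o |UNIV :: 'a set|"
    using assms infinite_iff_card_of_nat by blast
  then have "|UNIV \<times> UNIV :: (nat \<times> 'a) set| =o |UNIV :: 'a set|"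
    using card_of_Times_infinite[of "UNIV :: 'a set" "UNIV :: nat set"] assms by simp
  then have "|UNIV \<times> UNIV :: (nat \<times> 'a) set| \<le>o |UNIV :: 'a set|"
    by (rule ordIso_imp_ordLeq)
  then show ?thesis by (simp add: card_of_ordLeq[symmetric])
qed

lemma conucleus_term_chain:
  fixes A :: "'a hoop"
  assumes inf: "infinite (UNIV :: 'a set)" and con: "conucleus_term_on (WH :: 'a hoop set) t"
    and "wajsberg_chain A" and x: "x \<in> carrier A"
  shows "term_op A t x = x"
proof -
  interpret wajsberg_chain A by fact
  obtain f :: "nat \<times> 'a \<Rightarrow> 'a" where f: "inj f" using exists_inj_nat_times[OF inf] by blast
  obtain g :: "nat \<Rightarrow> 'a" where "inj g" using inf by (auto simp: infinite_iff_countable_subset)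
  then have deg: "term_degree t = 1"
    using conucleus_transport[OF con nat_hoop] conucleus_term_degree inj_on_subset by blast
  show ?thesis
  proof (cases "\<exists>z\<in>carrier A. \<forall>a\<in>carrier A. z \<preceq>\<^bsub>A\<^esub> a")
    case False
    then show ?thesis using term_op_eq_self_of_unbounded[OF deg x] by blast
  next
    case True
    then obtain z where z: "z \<in> carrier A" "\<And>a. a \<in> carrier A \<Longrightarrow> z \<preceq>\<^bsub>A\<^esub> a" by blast
    show ?thesis
    proof (cases "z = \<one>\<^bsub>A\<^esub>")
      \<comment> \<open>A chain with least element \<open>\<one>\<close> is trivial; it is treated
        apart because the cover requires \<open>z \<noteq> \<one>\<close>.\<close>
      case True
      then have "a = \<one>\<^bsub>A\<^esub>" if "a \<in> carrier A" for a using z(2)[OF that] that by (simp add: one_le_iff)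
      then show ?thesis using x term_op_closed by metis
    next
      case False
      interpret bounded_wajsberg_chain A z by unfold_locales (use z False in auto)
      show ?thesis
      proof (rule term_op_eq_self[OF deg _ x])
        fix d assume "d \<in> carrier cover"
        then interpret D: wajsberg_chain "interval_hoop cover d" by (rule cover.wajsberg_chain_interval)
        show "conucleus (interval_hoop cover d) (term_op (interval_hoop cover d) t)"
          using conucleus_transport[OF con D.wajsberg_hoop_axioms] f inj_on_subset by blast
      qed
    qed
  qed
qed

theorem proposition4p2:
  fixes t :: hoop_term
  assumes "infinite (UNIV :: 'a set)"
  shows "conucleus_term_on (WH :: 'a hoop set) t \<longleftrightarrow> (WH :: 'a hoop set) \<Turnstile> t \<approx> Var"
proof
  assume con: "conucleus_term_on (WH :: 'a hoop set) t"
  show "(WH :: 'a hoop set) \<Turnstile> t \<approx> Var"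
    unfolding satisfies_eq_def
  proof (intro ballI)
    fix A :: "'a hoop" and x assume "A \<in> WH" and x: "x \<in> carrier A"
    then interpret wajsberg_hoop A by (simp add: WH_def)
    interpret T: conucleus A "term_op A t"
      using con \<open>A \<in> WH\<close> by (simp add: conucleus_term_on_def)
    \<comment> \<open>Contraction gives one inequality, and \<open>?c = \<one>\<close> is the other.
      Were it false, some chain quotient would separate \<open>?c\<close> from
      \<open>\<one>\<close>, although \<open>t\<close> is the identity there.\<close>
    let ?c = "x \<leadsto>\<^bsub>A\<^esub> term_op A t x"
    have "?c = \<one>\<^bsub>A\<^esub>"
    proof (rule ccontr)
      assume "?c \<noteq> \<one>\<^bsub>A\<^esub>"
      then obtain C :: "'a hoop" and h where C: "wajsberg_chain C" "hoop_hom A C h"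
        and hc: "h ?c \<noteq> \<one>\<^bsub>C\<^esub>"
        using exists_chain_quotient[of ?c] x by auto
      interpret C: wajsberg_chain C by (rule C(1))
      have hx: "h x \<in> carrier C" using C(2) x by (auto simp: hoop_hom_def)
      have "h (term_op A t x) = h x"
        using term_op_hom[OF hoop_axioms C(2) x, of t] conucleus_term_chain[OF assms con C(1) hx] by simp
      then have "h ?c = h x \<leadsto>\<^bsub>C\<^esub> h x" using C(2) x by (simp add: hoop_hom_def)
      then show False using hc hx by (simp add: C.imp_refl)
    qed
    then have "term_op A t x = x"
      using T.contracting[OF x] x by (intro le_antisym) (simp_all add: hoop_le_def)
    then show "term_op A t x = term_op A Var x" by simp
  qed
next
  assume eq: "(WH :: 'a hoop set) \<Turnstile> t \<approx> Var"
  show "conucleus_term_on (WH :: 'a hoop set) t"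
    unfolding conucleus_term_on_def
  proof
    fix A :: "'a hoop" assume A: "A \<in> WH"
    then interpret wajsberg_hoop A by (simp add: WH_def)
    have "term_op A t x = x" if "x \<in> carrier A" for x
      using eq A that by (simp add: satisfies_eq_def)
    then show "conucleus A (term_op A t)" by unfold_locales simp_all
  qed
qed

end
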